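(* Let $m\ge 1$ be an integer. The Golomb counting function $g_m(t)$ (for positive integers $t$) is a quasipolynomial in $t$ of degree $m-1$ with leading coefficient $\frac{1}{(m-1)!}$. For every positive integer $t$, the evaluation $(-1)^{m-1} g_m(-t)$ of this quasipolynomial equals the number of rulers in $\mathbb{Z}_{\ge 0}^m$ of length $t$, each counted with its Golomb multiplicity. Furthermore, $(-1)^{m-1} g_m(0)$ equals the number of combinatorially different Golomb rulers with $m+1$ markings.
   Context: Write $[m]=\{1,2,\dots,m\}$. The abbreviation dpcs stands for disjoint proper consecutive subsets of $[m]$: two sets of the form $U=\{a,a+1,\dots,b\}$ and $V=\{c,c+1,\dots,d\}$ for some $1\le a\le b<c\le d\le m$. The Golomb counting function is, for a positive integer $t$, $$g_m(t)=\#\{x\in\mathbb{Z}^{m+1}: 0=x_0<x_1<\dots<x_{m-1}<x_m=t,\ \text{all differences } x_j-x_k\ (j>k) \text{ distinct}\},$$ equivalently $$g_m(t)=\#\Big\{z\in\mathbb{Z}_{>0}^m: z_1+\dots+z_m=t,\ \sum_{j\in U}z_j\ne\sum_{j\in V}z_j \text{ for all dpcs } U,V\subset[m]\Big\}.$$ A ruler of length $t$ is a point $z\in\mathbb{Z}_{\ge 0}^m$ with $z_1+\dots+z_m=t$. A Golomb ruler (with $m+1$ markings) is a ruler with positive entries satisfying $\sum_{j\in U}z_j\ne\sum_{j\in V}z_j$ for all dpcs $U,V\subset[m]$. A real Golomb ruler (with $m+1$ markings and length $t$) is a vector $z\in\mathbb{R}_{\ge 0}^m$ with $z_1+\dots+z_m=t$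 and $\sum_{j\in U}z_j\ne\sum_{j\in V}z_j$ for all dpcs $U,V\subset[m]$. Two real Golomb rulers $z,w\in\mathbb{R}_{\ge0}^m$ are combinatorially equivalent if for any dpcs $U,V\subset[m]$, $$\sum_{j\in U}z_j<\sum_{j\in V}z_j\iff\sum_{j\in U}w_j<\sum_{j\in V}w_j;$$ otherwise they are combinatorially different. The number of combinatorially different Golomb rulers means the number of equivalence classes (the length being arbitrary). The Golomb multiplicity of a ruler $z\in\mathbb{Z}_{\ge0}^m$ is the number of combinatorially different real Golomb rulers in an $\epsilon$-neighborhood of $z$ (viewed as a point of $\mathbb{R}^m$), for sufficiently small $\epsilon>0$. A quasipolynomial of degree $d$ is a function of the form $c_d(t)t^d+c_{d-1}(t)t^{d-1}+\dots+c_0(t)$ where the $c_j(t)$ are periodic functions of the integer $t$; evaluations at $0$ and at negative integers are those of the quasipolynomial that agrees with the counting function at positive integers. *)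

theory Defs
  imports "HOL-Analysis.Analysis"
begin

text \<open>
  A vector indexed by a set \<open>I\<close> of natural numbers is an extensional function in
  \<open>I \<rightarrow>\<^sub>E A\<close>, so that distinct functions are distinct vectors and cardinalities are right.
\<close>

definition dpcs :: "nat \<Rightarrow> nat set \<Rightarrow> nat set \<Rightarrow> bool" where
  "dpcs m U V \<longleftrightarrow>
     (\<exists>a b c d. 1 \<le> a \<and> a \<le> b \<and> b < c \<and> c \<le> d \<and> d \<le> m \<and> U = {a..b} \<and> V = {c..d})"

definition golomb_count :: "nat \<Rightarrow> int \<Rightarrow> nat" where
  "golomb_count m t =
     card {x \<in> {0..m} \<rightarrow>\<^sub>E (UNIV :: int set).
             x 0 = 0 \<and> x m = t \<and> strict_mono_on {0..m} x \<and>
             inj_on (\<lambda>(j, k). x j - x k) {(j, k). k < j \<and> j \<le> m}}"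

definition rulers :: "nat \<Rightarrow> int \<Rightarrow> (nat \<Rightarrow> int) set" where
  "rulers m t = {z \<in> {1..m} \<rightarrow>\<^sub>E {0..}. (\<Sum>j\<in>{1..m}. z j) = t}"

definition real_golomb_rulers_of_length :: "nat \<Rightarrow> real \<Rightarrow> (nat \<Rightarrow> real) set" where
  "real_golomb_rulers_of_length m t =
     {z \<in> {1..m} \<rightarrow>\<^sub>E {0..}. (\<Sum>j\<in>{1..m}. z j) = t \<and>
        (\<forall>U V. dpcs m U V \<longrightarrow> (\<Sum>j\<in>U. z j) \<noteq> (\<Sum>j\<in>V. z j))}"

definition real_golomb_rulers :: "nat \<Rightarrow> (nat \<Rightarrow> real) set" where
  "real_golomb_rulers m = (\<Union>t. real_golomb_rulers_of_length m t)"

definition comb_equiv :: "nat \<Rightarrow> ((nat \<Rightarrow> real) \<times> (nat \<Rightarrow> real)) set" where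
  "comb_equiv m =
     {(z, w). z \<in> real_golomb_rulers m \<and> w \<in> real_golomb_rulers m \<and>
        (\<forall>U V. dpcs m U V \<longrightarrow>
           ((\<Sum>j\<in>U. z j) < (\<Sum>j\<in>V. z j) \<longleftrightarrow> (\<Sum>j\<in>U. w j) < (\<Sum>j\<in>V. w j)))}"

text \<open>
  For a set \<open>S\<close> of real Golomb rulers, \<open>S // comb_equiv m\<close> is the set of equivalence
  classes (in the set of all real Golomb rulers) that meet \<open>S\<close>.
\<close>

definition num_comb_different :: "nat \<Rightarrow> (nat \<Rightarrow> real) set \<Rightarrow> nat" where
  "num_comb_different m S = card (S // comb_equiv m)"

text \<open>
  The number of classes meeting the Euclidean \<open>\<epsilon>\<close>-ball around \<open>z\<close> can only
  decrease as \<open>\<epsilon>\<close> shrinks, so it is eventually constant and the description below is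
  proper.
\<close>

definition golomb_multiplicity :: "nat \<Rightarrow> (nat \<Rightarrow> int) \<Rightarrow> nat" where
  "golomb_multiplicity m z =
     (THE n. \<forall>\<^sub>F \<epsilon> in at_right (0 :: real).
        num_comb_different m
          {w \<in> real_golomb_rulers m. L2_set (\<lambda>j. w j - real_of_int (z j)) {1..m} < \<epsilon>} = n)"

definition periodic :: "(int \<Rightarrow> real) \<Rightarrow> bool" where
  "periodic f \<longleftrightarrow> (\<exists>p > 0. \<forall>t. f (t + p) = f t)"

text \<open>
  The function \<open>q\<close> is a quasipolynomial of degree \<open>d\<close> with coefficient functions
  \<open>c 0, \<dots>, c d\<close>.
\<close>

definition quasipolynomial :: "nat \<Rightarrow> (nat \<Rightarrow> int \<Rightarrow> real) \<Rightarrow> (int \<Rightarrow> real) \<Rightarrow> bool" where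
  "quasipolynomial d c q \<longleftrightarrow>
     (\<forall>j\<le>d. periodic (c j)) \<and> c d \<noteq> (\<lambda>_. 0) \<and>
     (\<forall>t. q t = (\<Sum>j\<le>d. c j t * real_of_int t ^ j))"

end

theory Submission
  imports Defs
begin

text \<open>
  Replace a ruler \<open>z\<close> by its marks \<open>x j = z 1 + \<dots> + z j\<close>. The Golomb condition then says that
  \<open>x\<close> avoids finitely many hyperplanes through the origin, and these cut the open cone
  \<open>0 < x 1 < \<dots> < x m\<close> into finitely many open polyhedral cones, one for each combinatorial type.
  So the Golomb count at \<open>t\<close> is the number of lattice points with \<open>x m = t\<close> in the union of these
  open cones. A type occurs arbitrarily close to \<open>z\<close> exactly when \<open>z\<close> lies in the closure of its
  cone (lemma \<open>golomb_multiplicity_eq\<close>), so the rulers of length \<open>t\<close>, weighted by multiplicity,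
  are the lattice points of all the closed cones. The theorem thereby reduces to Ehrhart
  reciprocity for a single cone (\<open>cone_reciprocity\<close>), where the closed cone has the one lattice
  point \<open>0\<close> at \<open>t = 0\<close>.

  Reciprocity is proved by summing out one mark after the other. Fix a point \<open>v\<close> of the open cone
  whose coordinates are linearly independent over the rationals. A lattice point \<open>y\<close> lies in the
  closed cone iff \<open>y + \<epsilon> v\<close> lies in the open cone for all small \<open>\<epsilon> > 0\<close>, and it lies in the open
  cone iff \<open>y - \<epsilon> v\<close> does. Since a perturbed lattice point is on no rational hyperplane, cones
  can be cut along such hyperplanes without counting any point twice. Cut until the mark that is
  summed out has one lower bound and one upper bound; with an antidifference \<open>Q\<close> of the summand
  \<open>q\<close>, the sum is the value of \<open>Q\<close> at the upper bound minus its value just below the lower bound,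
  again a quasipolynomial on a perturbed cone. Passing from \<open>v\<close> to \<open>- v\<close> and from \<open>y\<close> to
  \<open>- y\<close> turns each bound \<open>e\<close> into \<open>- e - 1\<close>, which only changes the sign of the sum. Hence
  pairs of the form ``\<open>q y\<close> on a cone perturbed by \<open>v\<close>, \<open>q (- y)\<close> on the same cone perturbed by
  \<open>- v\<close>'' are preserved up to a sign (\<open>reciprocal_pair_sum_between\<close>); after \<open>m - 1\<close>
  summations only the variable \<open>t\<close> is left, and the sign has become \<open>(-1) ^ (m - 1)\<close>.

  For the leading coefficient, all but \<open>O(t ^ (m - 2))\<close> of the \<open>(t - 1) choose (m - 1)\<close>
  compositions of \<open>t\<close> are Golomb rulers, so the count divided by \<open>t ^ (m - 1)\<close> tends to
  \<open>1 / fact (m - 1)\<close>. This limit, taken along each residue class, kills all higher coefficients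
  and makes the coefficient of \<open>t ^ (m - 1)\<close> constant (\<open>leading_coefficient_from_limit\<close>).
\<close>


section \<open>Quasipolynomials in several variables\<close>

lemma periodic_const: "periodic (\<lambda>_. c)"
  by (auto simp: periodic_def intro: exI[of _ 1])

lemma periodic_mult_period:
  assumes "\<forall>t. f (t + p) = (f t :: real)" shows "f (t + p * int n) = f t"
proof (induction n)
  case (Suc n)
  have "f (t + p * int (Suc n)) = f ((t + p * int n) + p)" by (simp add: algebra_simps)
  then show ?case using assms Suc by simp
qed simp

lemma periodic_map2:
  assumes "periodic f" "periodic g" shows "periodic (\<lambda>t. h (f t) (g t))"
proof -
  obtain p q where p: "p > 0" "\<forall>t. f (t + p) = f t" and q: "q > 0" "\<forall>t. g (t + q) = g t"
    using assms by (auto simp: periodic_def)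
  have "f (t + p * q) = f t" for t using periodic_mult_period[OF p(2), of t "nat q"] q by simp
  moreover have "g (t + p * q) = g t" for t
    using periodic_mult_period[OF q(2), of t "nat p"] p by (simp add: mult.commute)
  ultimately show ?thesis using p q by (auto simp: periodic_def intro!: exI[of _ "p * q"])
qed

lemmas periodic_add = periodic_map2[of _ _ "(+)"]
lemmas periodic_mult = periodic_map2[of _ _ "(*)"]

lemma periodic_of_mod: assumes "N > 0" shows "periodic (\<lambda>x. g (x mod N))"
  using assms by (auto simp: periodic_def intro!: exI[of _ N])

lemma periodic_eq_mod:
  fixes p :: "int \<Rightarrow> real" assumes "\<forall>t. p (t + N) = p t" "N > 0" shows "p x = p (x mod N)"
proof (cases "x div N \<ge> 0")
  case True
  then show ?thesis using periodic_mult_period[OF assms(1), of "x mod N" "nat (x div N)"] by simp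
next
  case False
  have "x mod N = x + N * int (nat (- (x div N)))" using False
    by (simp add: minus_mult_div_eq_mod [symmetric])
  then show ?thesis using periodic_mult_period[OF assms(1), of x "nat (- (x div N))"] by simp
qed

text \<open>
  Quasipolynomials as the algebra generated by the coordinates and by the functions of the
  residues of all coordinates modulo some \<open>N\<close>. Arguments are vectors with infinitely many
  entries, so that no index set has to be carried along.
\<close>
inductive qpoly :: "((nat \<Rightarrow> int) \<Rightarrow> real) \<Rightarrow> bool" where
  coord: "qpoly (\<lambda>y. of_int (y i))"
| residue: "N > 0 \<Longrightarrow> (\<And>y y'. (\<And>i. y i mod N = y' i mod N) \<Longrightarrow> g y = g y') \<Longrightarrow> qpoly g"
| add: "qpoly f \<Longrightarrow> qpoly g \<Longrightarrow> qpoly (\<lambda>y. f y + g y)"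
| mult: "qpoly f \<Longrightarrow> qpoly g \<Longrightarrow> qpoly (\<lambda>y. f y * g y)"

lemma qpoly_const: "qpoly (\<lambda>_. c)" by (rule qpoly.residue[of 1]) auto

lemma qpoly_diff: "qpoly f \<Longrightarrow> qpoly g \<Longrightarrow> qpoly (\<lambda>y. f y - g y)"
  using qpoly.add[OF _ qpoly.mult[OF qpoly_const[of "-1"]]] by simp

lemma qpoly_sum: "finite A \<Longrightarrow> (\<And>i. i \<in> A \<Longrightarrow> qpoly (f i)) \<Longrightarrow> qpoly (\<lambda>y. \<Sum>i\<in>A. f i y)"
  by (induction A rule: finite_induct) (auto intro: qpoly_const qpoly.add)

lemma qpoly_poly: "qpoly f \<Longrightarrow> qpoly (\<lambda>y. poly p (f y))"
  by (induction p) (auto intro: qpoly_const qpoly.mult qpoly.add)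

text \<open>
  A normal form that isolates the variable \<open>y k\<close>: finite sums of a univariate quasi-monomial
  in \<open>y k\<close> times a quasipolynomial that ignores \<open>y k\<close>. Antidifferences in \<open>y k\<close> and
  restrictions to a line can be taken term by term.
\<close>
inductive separated :: "nat \<Rightarrow> ((nat \<Rightarrow> int) \<Rightarrow> real) \<Rightarrow> bool" for k where
  zero: "separated k (\<lambda>_. 0)"
| add_term: "\<lbrakk>separated k f; periodic p; qpoly h; \<And>y x. h (y(k := x)) = h y\<rbrakk> \<Longrightarrow>
     separated k (\<lambda>y. f y + p (y k) * of_int (y k) ^ j * h y)"

lemma separated_term:
  "\<lbrakk>periodic p; qpoly h; \<And>y x. h (y(k := x)) = h y\<rbrakk> \<Longrightarrow> separated k (\<lambda>y. p (y k) * of_int (y k) ^ j * h y)"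
  using separated.add_term[OF separated.zero] by simp

lemma separated_add: assumes "separated k f" "separated k g" shows "separated k (\<lambda>y. f y + g y)"
  using assms(2)
proof induction
  case zero then show ?case using assms(1) by simp
next
  case (add_term g p h j)
  from separated.add_term[OF add_term.IH add_term.hyps(2-4), of j] show ?case
    by (simp add: add.assoc)
qed

lemma separated_sum: "finite A \<Longrightarrow> (\<And>i. i \<in> A \<Longrightarrow> separated k (f i)) \<Longrightarrow> separated k (\<lambda>y. \<Sum>i\<in>A. f i y)"
  by (induction A rule: finite_induct) (auto intro: separated.zero separated_add)

lemma separated_mult_term:
  assumes "separated k f" "periodic p" "qpoly h" "\<And>y x. h (y(k := x)) = h y"
  shows "separated k (\<lambda>y. f y * (p (y k) * of_int (y k) ^ j * h y))"
  using assms(1)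
proof induction
  case zero show ?case using separated.zero by simp
next
  case (add_term f p' h' i)
  have "separated k (\<lambda>y. f y * (p (y k) * of_int (y k) ^ j * h y) +
       (p' (y k) * p (y k)) * of_int (y k) ^ (i + j) * (h' y * h y))"
    by (rule separated.add_term[OF add_term.IH periodic_map2[OF add_term.hyps(2) assms(2), of "(*)"]
          qpoly.mult[OF add_term.hyps(3) assms(3)]]) (simp add: add_term.hyps(4) assms(4))
  then show ?case by (simp add: algebra_simps power_add)
qed

lemma separated_mult: assumes "separated k f" "separated k g" shows "separated k (\<lambda>y. f y * g y)"
  using assms(2)
proof induction
  case zero then show ?case using separated.zero by simp
next
  case (add_term g p h j)
  from separated_add[OF add_term.IH separated_mult_term[OF assms(1) add_term.hyps(2-4)], of j] show ?case
    by (simp add: algebra_simps)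
qed

text \<open>
  Only a function of residues is not already in normal form; it is split according to the
  residue class of \<open>y k\<close>.
\<close>
lemma qpoly_imp_separated: "qpoly f \<Longrightarrow> separated k f"
proof (induction rule: qpoly.induct)
  case (coord i)
  show ?case
  proof (cases "i = k")
    case True then show ?thesis
      using separated_term[OF periodic_const[of 1] qpoly_const[of 1], of k 1] by simp
  next
    case False
    then show ?thesis using separated_term[OF periodic_const[of 1] qpoly.coord[of i], of k 0] by simp
  qed
next
  case (residue N g)
  let ?t = "\<lambda>r y. of_bool (y k mod N = r) * of_int (y k) ^ 0 * g (y(k := r))"
  have "separated k (?t r)" for r
  proof (intro separated_term)
    show "periodic (\<lambda>x. of_bool (x mod N = r))"
      using periodic_of_mod[OF residue(1), of "\<lambda>x. of_bool (x = r)"] .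
    show "qpoly (\<lambda>y. g (y(k := r)))"
      by (rule qpoly.residue[OF residue(1)]) (rule residue(2), auto)
  qed auto
  then have "separated k (\<lambda>y. \<Sum>r\<in>{0..<N}. ?t r y)" by (intro separated_sum) auto
  moreover have "(\<Sum>r\<in>{0..<N}. ?t r y) = g y" for y
  proof -
    have "(\<Sum>r\<in>{0..<N}. ?t r y) = (\<Sum>r\<in>{0..<N}. if r = y k mod N then g (y(k := y k mod N)) else 0)"
      by (intro sum.cong) auto
    also have "\<dots> = g (y(k := y k mod N))" using residue(1) by simp
    also have "\<dots> = g y" by (rule residue(2)) auto
    finally show ?thesis .
  qed
  ultimately show ?case by simp
qed (auto intro: separated_add separated_mult)

text \<open>
  The difference of \<open>x ^ (j + 1)\<close> is \<open>(j + 1) x ^ j\<close> plus lower powers, which have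
  antidifferences by induction.
\<close>
lemma power_antidifference: "\<exists>P. \<forall>x::real. poly P x - poly P (x - 1) = x ^ j"
proof (induction j rule: less_induct)
  case (less j)
  then obtain P where P: "\<And>i x. i < j \<Longrightarrow> poly (P i) x - poly (P i) (x - 1) = (x::real) ^ i" by metis
  define c :: "nat \<Rightarrow> real" where "c i = of_nat (Suc j choose i) * (-1) ^ (Suc j - i)" for i :: nat
  have binom: "(x - 1) ^ Suc j = x ^ Suc j - real (Suc j) * x ^ j + (\<Sum>i<j. c i * x ^ i)" for x :: real
  proof -
    have "(x - 1) ^ Suc j = (\<Sum>i\<le>Suc j. of_nat (Suc j choose i) * x ^ i * (-1) ^ (Suc j - i))"
      using binomial_ring[of x "-1" "Suc j"] by simp
    also have "\<dots> = (\<Sum>i\<le>Suc j. c i * x ^ i)" by (intro sum.cong) (auto simp: c_def)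
    also have "\<dots> = (\<Sum>i<j. c i * x ^ i) + c j * x ^ j + c (Suc j) * x ^ Suc j"
      by (simp only: lessThan_Suc_atMost[symmetric] sum.lessThan_Suc)
    also have "\<dots> = x ^ Suc j - real (Suc j) * x ^ j + (\<Sum>i<j. c i * x ^ i)"
      by (simp add: c_def algebra_simps)
    finally show ?thesis .
  qed
  define Q where "Q = smult (1 / real (Suc j)) (monom 1 (Suc j) + (\<Sum>i<j. smult (c i) (P i)))"
  have "poly Q x - poly Q (x - 1) = x ^ j" for x
  proof -
    have "(\<Sum>i<j. c i * poly (P i) x) - (\<Sum>i<j. c i * poly (P i) (x - 1)) = (\<Sum>i<j. c i * x ^ i)"
      unfolding sum_subtractf[symmetric] right_diff_distrib[symmetric] by (intro sum.cong) (auto simp: P)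
    then have "x ^ Suc j + (\<Sum>i<j. c i * poly (P i) x) - ((x - 1) ^ Suc j +
      (\<Sum>i<j. c i * poly (P i) (x - 1)))
       = real (Suc j) * x ^ j" unfolding binom by simp
    moreover have "poly Q x - poly Q (x - 1) = (x ^ Suc j + (\<Sum>i<j. c i * poly (P i) x) -
      ((x - 1) ^ Suc j + (\<Sum>i<j. c i * poly (P i) (x - 1)))) / real (Suc j)"
      unfolding Q_def by (simp add: poly_monom poly_sum diff_divide_distrib del: power_Suc)
    ultimately show ?thesis by simp
  qed
  then show ?case by blast
qed

lemma poly_antidifference: "\<exists>P. \<forall>x::real. poly P x - poly P (x - 1) = poly p x"
proof -
  obtain P where P: "\<And>i x. poly (P i) x - poly (P i) (x - 1) = (x::real) ^ i"
    using power_antidifference by metis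
  define Q where "Q = (\<Sum>i\<le>degree p. smult (coeff p i) (P i))"
  have "poly Q x - poly Q (x - 1) = poly p x" for x
    unfolding Q_def poly_sum poly_smult sum_subtractf[symmetric] right_diff_distrib[symmetric] P
    by (simp add: poly_altdef)
  then show ?thesis by blast
qed

text \<open>
  On the class of \<open>r\<close> modulo \<open>N\<close> write \<open>x = r + N u\<close>. A polynomial antidifference in \<open>u\<close>,
  evaluated at \<open>(x - r) div N\<close>, jumps exactly when \<open>x\<close> passes through the class of \<open>r\<close>, so
  adding these over all \<open>r\<close> gives an antidifference in \<open>x\<close>.
\<close>
lemma periodic_power_antidifference:
  assumes "periodic p"
  shows "\<exists>P. (\<forall>x::int. P x - P (x - 1) = p x * of_int x ^ j) \<and> qpoly (\<lambda>y. P (y k))"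
proof -
  obtain N where N: "N > 0" "\<forall>t. p (t + N) = p t" using assms by (auto simp: periodic_def)
  obtain R where R: "\<And>r x. poly (R r) x - poly (R r) (x - 1) =
    poly ([:of_int r, of_int N:] ^ j) (x::real)"
    using choice[of "\<lambda>r R. \<forall>x. poly R x - poly R (x - 1) = poly ([:of_int r, of_int N:] ^ j) (x::real)"]
      poly_antidifference by blast
  define P where "P x = (\<Sum>r\<in>{0..<N}. p r * poly (R r) (of_int ((x - r) div N)))" for x
  have "P x - P (x - 1) = p x * of_int x ^ j" for x
  proof -
    have "p r * poly (R r) (of_int ((x - r) div N)) - p r * poly (R r) (of_int ((x - 1 - r) div N))
       = (if r = x mod N then p x * of_int x ^ j else 0)" if r: "r \<in> {0..<N}" for r
    proof (cases "r = x mod N")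
      case True
      define u where "u = x div N"
      have x: "x = r + N * u" unfolding u_def True by simp
      have "(x - r) div N = u" "(x - 1 - r) div N = u - 1"
        using N x div_mult_self2[of N "-1" u] div_eq_minus1[OF N(1)] by (auto simp: algebra_simps)
      then have "p r * poly (R r) (of_int ((x - r) div N)) - p r * poly (R r) (of_int ((x - 1 - r)
        div N))
         = p r * poly ([:of_int r, of_int N:] ^ j) (of_int u)"
        using R[of r "of_int u"] by (simp add: right_diff_distrib[symmetric])
      also have "\<dots> = p x * of_int x ^ j"
      proof -
        have "p r = p x" using periodic_eq_mod[OF N(2,1), of x] True by simp
        moreover have "of_int r + of_int u * of_int N = real_of_int x" using x by simp
        ultimately show ?thesis by (simp add: poly_power)
      qed
      finally show ?thesis using True by simp
    next
      case False
      have "(x - r) mod N \<noteq> 0"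
      proof
        assume "(x - r) mod N = 0"
        then have "x mod N = r mod N" by (simp add: mod_eq_dvd_iff mod_eq_0_iff_dvd)
        with r False show False by simp
      qed
      then have "(x - 1 - r) div N = (x - r) div N"
      proof -
        define w where "w = (x - r) mod N"
        define u where "u = (x - r) div N"
        have w: "0 < w" "w < N" using \<open>(x - r) mod N \<noteq> 0\<close>
            pos_mod_sign[OF N(1), of "x - r"] pos_mod_bound[OF N(1), of "x - r"]
              unfolding w_def by linarith+
        have "x - r = w + N * u" by (simp add: w_def u_def)
        then have "x - 1 - r = (w - 1) + N * u" by simp
        then have "(x - 1 - r) div N = (w - 1) div N + u"
          using N by (metis div_mult_self2 less_irrefl add.commute)
        then show ?thesis using w by (simp add: u_def)
      qed
      then show ?thesis using False by simp
    qed
    then have "P x - P (x - 1) = (\<Sum>r\<in>{0..<N}. if r = x mod N then p x * of_int x ^ j else 0)"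
      unfolding P_def sum_subtractf[symmetric] by (intro sum.cong) auto
    then show ?thesis using N by simp
  qed
  moreover have "qpoly (\<lambda>y. P (y k))" unfolding P_def
  proof (intro qpoly_sum qpoly.mult qpoly_const qpoly_poly)
    fix r
    have "qpoly (\<lambda>y. (1 / of_int N) * ((of_int (y k) - of_int r) - of_int ((y k - r) mod N)))"
    proof (intro qpoly.mult qpoly_diff qpoly_const qpoly.coord)
      show "qpoly (\<lambda>y. real_of_int ((y k - r) mod N))"
      proof (rule qpoly.residue[OF N(1)])
        fix y y' :: "nat \<Rightarrow> int" assume "\<And>i. y i mod N = y' i mod N"
        then show "real_of_int ((y k - r) mod N) = real_of_int ((y' k - r) mod N)"
          by (metis mod_diff_left_eq)
      qed
    qed
    moreover have "(1 / of_int N) * ((of_int x - of_int r) - of_int ((x - r) mod N)) =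
      real_of_int ((x - r) div N)" for x
    proof -
      have "real_of_int (x - r) = of_int N * of_int ((x - r) div N) + of_int ((x - r) mod N)"
        by (metis mult_div_mod_eq of_int_add of_int_mult)
      then show ?thesis using N by (simp add: field_simps)
    qed
    ultimately show "qpoly (\<lambda>y. real_of_int ((y k - r) div N))" by simp
  qed auto
  ultimately show ?thesis by blast
qed

lemma qpoly_antidifference:
  assumes "qpoly q"
  shows "\<exists>Q. qpoly Q \<and> (\<forall>y. Q y - Q (y(k := y k - 1)) = q y)"
  using qpoly_imp_separated[OF assms, of k]
proof induction
  case zero show ?case using qpoly_const[of 0] by (intro exI[of _ "\<lambda>_. 0"]) auto
next
  case (add_term f p h j)
  then obtain Q where Q: "qpoly Q" "\<And>y. Q y - Q (y(k := y k - 1)) = f y" by blast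
  obtain P where P: "\<And>x. P x - P (x - 1) = p x * of_int x ^ j" "qpoly (\<lambda>y. P (y k))"
    using periodic_power_antidifference[OF add_term.hyps(2)] by metis
  have "(Q y + P (y k) * h y) - (Q (y(k := y k - 1)) + P ((y(k := y k - 1)) k) * h (y(k := y k - 1)))
     = f y + p (y k) * of_int (y k) ^ j * h y" for y
    using Q(2)[of y] add_term.hyps(4)[of y] by (simp add: P(1)[symmetric] algebra_simps)
  moreover have "qpoly (\<lambda>y. Q y + P (y k) * h y)" by (intro qpoly.add qpoly.mult Q P add_term)
  ultimately show ?case by blast
qed

text \<open>
  Telescoping. The range may be empty, but only in the form \<open>u = l - 1\<close>; for a smaller \<open>u\<close> the
  right-hand side would count with the wrong sign.
\<close>
lemma qpoly_antidifference_sum: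
  assumes "\<And>y::nat \<Rightarrow> int. Q y - Q (y(k := y k - 1)) = (q y :: real)" and "l - 1 \<le> u"
  shows "(\<Sum>x\<in>{l..u}. q (y(k := x))) = Q (y(k := u)) - Q (y(k := l - 1))"
proof -
  have "(\<Sum>x\<in>{l..l + int n - 1}. q (y(k := x))) = Q (y(k := l + int n - 1)) - Q (y(k := l - 1))" for n
  proof (induction n)
    case (Suc n)
    have "{l..l + int (Suc n) - 1} = insert (l + int n) {l..l + int n - 1}" by auto
    then have "(\<Sum>x\<in>{l..l + int (Suc n) - 1}. q (y(k := x))) =
      q (y(k := l + int n)) + (\<Sum>x\<in>{l..l + int n - 1}. q (y(k := x)))"
      by (simp del: fun_upd_apply of_nat_Suc)
    also note Suc
    also have "q (y(k := l + int n)) = Q (y(k := l + int n)) - Q (y(k := l + int n - 1))"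
      using assms(1)[of "y(k := l + int n)"] by simp
    finally show ?case by (simp add: algebra_simps del: fun_upd_apply)
  qed simp
  from this[of "nat (u + 1 - l)"] show ?thesis using assms(2) by simp
qed

definition univariate_qpoly :: "(int \<Rightarrow> real) \<Rightarrow> bool" where
  "univariate_qpoly f \<longleftrightarrow> (\<exists>d c. (\<forall>j. periodic (c j)) \<and> (\<forall>t. f t = (\<Sum>j\<le>d. c j t * of_int t ^ j)))"

lemma univariate_qpoly_term: assumes "periodic p" shows "univariate_qpoly (\<lambda>t. p t * of_int t ^ j)"
  unfolding univariate_qpoly_def
proof (intro exI conjI allI)
  show "periodic (\<lambda>t. if i = j then p t else 0)" for i using assms periodic_const[of 0]
    by (cases "i = j") auto
  show "p t * of_int t ^ j = (\<Sum>i\<le>j. (if i = j then p t else 0) * of_int t ^ i)" for t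
    by (simp add: if_distrib[of "\<lambda>x. x * _"] cong: if_cong)
qed

lemma univariate_qpoly_zero: "univariate_qpoly (\<lambda>_. 0)"
  using univariate_qpoly_term[OF periodic_const[of 0], of 0] by simp

lemma univariate_qpoly_add: assumes "univariate_qpoly f" "univariate_qpoly g" shows
  "univariate_qpoly (\<lambda>t. f t + g t)"
proof -
  obtain d c where f: "\<And>j. periodic (c j)" "\<And>t. f t = (\<Sum>j\<le>d. c j t * of_int t ^ j)"
    using assms(1) unfolding univariate_qpoly_def by blast
  obtain d' c' where g: "\<And>j. periodic (c' j)" "\<And>t. g t = (\<Sum>j\<le>d'. c' j t * of_int t ^ j)"
    using assms(2) unfolding univariate_qpoly_def by blast
  define b where "b j t = (if j \<le> d then c j t else 0) + (if j \<le> d' then c' j t else 0)" for j t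
  have "periodic (\<lambda>t. if j \<le> d then c j t else 0)" "periodic (\<lambda>t. if j \<le> d' then c' j t else 0)" for j
    using f(1) g(1) periodic_const[of 0] by (cases "j \<le> d"; cases "j \<le> d'"; simp)+
  then have "periodic (b j)" for j unfolding b_def by (rule periodic_add)
  moreover have "f t + g t = (\<Sum>j\<le>max d d'. b j t * of_int t ^ j)" for t
  proof -
    have "(\<Sum>j\<le>max d d'. (if j \<le> d then c j t else 0) * of_int t ^ j) = f t" unfolding f(2)
      by (intro sum.mono_neutral_cong_right) auto
    moreover have "(\<Sum>j\<le>max d d'. (if j \<le> d' then c' j t else 0) * of_int t ^ j) = g t" unfolding g(2)
      by (intro sum.mono_neutral_cong_right) auto
    ultimately show ?thesis by (simp add: b_def distrib_right sum.distrib)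
  qed
  ultimately show ?thesis unfolding univariate_qpoly_def by blast
qed

lemma univariate_qpoly_sum: "finite A \<Longrightarrow> (\<And>i. i \<in> A \<Longrightarrow> univariate_qpoly (f i)) \<Longrightarrow>
  univariate_qpoly (\<lambda>y. \<Sum>i\<in>A. f i y)"
  by (induction A rule: finite_induct) (auto intro: univariate_qpoly_zero univariate_qpoly_add)

lemma periodic_reflect: assumes "periodic f" shows "periodic (\<lambda>t. f (- t))"
proof -
  obtain p where p: "p > 0" "\<And>t. f (t + p) = f t" using assms by (auto simp: periodic_def)
  have "f (- (t + p)) = f (- t)" for t using p(2)[of "- (t + p)"] by simp
  with p show ?thesis by (auto simp: periodic_def)
qed

lemma univariate_qpoly_reflect: assumes "univariate_qpoly f" shows "univariate_qpoly (\<lambda>t. s * f (- t))"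
proof -
  obtain d c where f: "\<And>j. periodic (c j)" "\<And>t. f t = (\<Sum>j\<le>d. c j t * of_int t ^ j)"
    using assms(1) unfolding univariate_qpoly_def by blast
  have "periodic (\<lambda>t. s * (-1) ^ j * c j (- t))" for j
    by (intro periodic_mult periodic_const periodic_reflect f)
  moreover have "s * f (- t) = (\<Sum>j\<le>d. (s * (-1) ^ j * c j (- t)) * of_int t ^ j)" for t
    unfolding f(2) sum_distrib_left
    by (intro sum.cong refl) (subst of_int_minus, subst power_minus, simp)
  ultimately show ?thesis unfolding univariate_qpoly_def
    by (intro exI[of _ d] exI[of _ "\<lambda>j t. s * (-1) ^ j * c j (- t)"]) simp
qed

lemma qpoly_line: assumes "qpoly q" shows "univariate_qpoly (\<lambda>t. q ((\<lambda>_. 0)(k := t)))"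
  using qpoly_imp_separated[OF assms, of k]
proof induction
  case zero show ?case by (rule univariate_qpoly_zero)
next
  case (add_term f p h j)
  have "univariate_qpoly (\<lambda>t. f ((\<lambda>_. 0)(k := t)) + (\<lambda>t. p t * h (\<lambda>_. 0)) t * of_int t ^ j)"
    by (intro univariate_qpoly_add add_term univariate_qpoly_term periodic_mult periodic_const)
  moreover have "h ((\<lambda>_. 0)(k := t)) = h (\<lambda>_. 0)" for t by (rule add_term.hyps(4))
  ultimately show ?case by (simp add: mult_ac fun_upd_same del: fun_upd_apply)
qed

section \<open>Perturbed cones and summing out a variable\<close>

definition lin :: "nat set \<Rightarrow> (nat \<Rightarrow> int) \<Rightarrow> (nat \<Rightarrow> 'a::comm_ring_1) \<Rightarrow> 'a" where
  "lin I a y = (\<Sum>i\<in>I. of_int (a i) * y i)"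

text \<open>
  For finite \<open>I\<close>: the coordinates of \<open>v\<close> in \<open>I\<close> are linearly independent over the rationals.
\<close>
definition generic :: "nat set \<Rightarrow> (nat \<Rightarrow> real) \<Rightarrow> bool" where
  "generic I v \<longleftrightarrow> finite I \<and> (\<forall>a. (\<exists>i\<in>I. a i \<noteq> 0) \<longrightarrow> lin I a v \<noteq> 0)"

text \<open>
  Positivity of the form \<open>a\<close> at \<open>y + \<epsilon> v\<close> for all sufficiently small \<open>\<epsilon> > 0\<close>. The forms that
  are positive at a given perturbed point form a convex cone, and for generic \<open>v\<close> every
  nonzero form or its negative is positive: perturbation removes all ties.
\<close>
definition perturbed_pos :: "nat set \<Rightarrow> (nat \<Rightarrow> real) \<Rightarrow> (nat \<Rightarrow> int) \<Rightarrow> (nat \<Rightarrow> int) \<Rightarrow> bool" where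
  "perturbed_pos I v a y \<longleftrightarrow> lin I a y > 0 \<or> lin I a y = 0 \<and> lin I a v > 0"

definition perturbed_cone :: "nat set \<Rightarrow> (nat \<Rightarrow> real) \<Rightarrow> (nat \<Rightarrow> int) set \<Rightarrow> (nat \<Rightarrow> int) \<Rightarrow> bool" where
  "perturbed_cone I v B y \<longleftrightarrow> (\<forall>a\<in>B. perturbed_pos I v a y)"

lemma lin_add: "lin I (\<lambda>i. a i + b i) y = lin I a y + lin I b y"
  by (simp add: lin_def distrib_right sum.distrib)

lemma lin_diff: "lin I (\<lambda>i. a i - b i) y = lin I a y - lin I b y"
  by (simp add: lin_def left_diff_distrib sum_subtractf)

lemma lin_scale: "lin I (\<lambda>i. c * a i) y = of_int c * lin I a y"
  by (simp add: lin_def sum_distrib_left mult.assoc)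

lemma lin_uminus: "lin I (\<lambda>i. - a i) y = - lin I a y"
  by (simp add: lin_def sum_negf)

lemma lin_uminus_arg: "lin I a (\<lambda>i. - y i) = - lin I a y"
  by (simp add: lin_def sum_negf)

lemma lin_upd:
  assumes "finite I" "k \<in> I"
  shows "lin I a (y(k := x)) = lin I a (y(k := 0)) + of_int (a k) * x"
  using assms by (simp add: lin_def sum.remove[of I k])

lemma generic_neg: "generic I v \<Longrightarrow> generic I (\<lambda>i. - v i)"
  by (simp add: generic_def lin_uminus_arg)

lemma perturbed_pos_neg_iff:
  assumes "generic I v" "\<exists>i\<in>I. a i \<noteq> 0"
  shows "perturbed_pos I v (\<lambda>i. - a i) y \<longleftrightarrow> \<not> perturbed_pos I v a y"
proof -
  have "lin I a v \<noteq> 0" using assms by (auto simp: generic_def)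
  then show ?thesis by (auto simp: perturbed_pos_def lin_uminus)
qed

lemma perturbed_pos_comb:
  assumes "perturbed_pos I v a y" "perturbed_pos I v b y" "c > 0" "d > 0"
  shows "perturbed_pos I v (\<lambda>i. c * a i + d * b i) y"
proof -
  have *: "x > 0 \<or> x = 0 \<and> x' > 0 \<Longrightarrow> z > 0 \<or> z = 0 \<and> z' > 0 \<Longrightarrow>
     of_int c * x + of_int d * z > 0 \<or> of_int c * x + of_int d * z = 0 \<and> real_of_int c * x' + of_int
       d * z' > 0"
    for x z :: int and x' z' :: real
    using assms(3,4) by (elim disjE conjE) (simp_all add: add_pos_pos)
  show ?thesis unfolding perturbed_pos_def lin_add lin_scale
    by (rule *) (use assms in \<open>auto simp: perturbed_pos_def\<close>)
qed

lemma perturbed_pos_scale: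
  assumes "c > 0"
  shows "perturbed_pos I v (\<lambda>i. c * a i) y \<longleftrightarrow> perturbed_pos I v a y"
  unfolding perturbed_pos_def lin_scale using assms by (auto simp: zero_less_mult_iff)

lemma perturbed_pos_cong: "(\<And>i. i \<in> I \<Longrightarrow> a i = b i) \<Longrightarrow> perturbed_pos I v a y \<longleftrightarrow> perturbed_pos I v b y"
  by (simp add: perturbed_pos_def lin_def)

lemma perturbed_pos_upd_irrelevant: "a k = 0 \<Longrightarrow> perturbed_pos I v a (y(k := x)) \<longleftrightarrow> perturbed_pos I v a y"
proof -
  assume "a k = 0"
  then have "lin I a (y(k := x)) = lin I a y" unfolding lin_def by (intro sum.cong) auto
  then show ?thesis by (simp add: perturbed_pos_def)
qed

text \<open>
  The perturbed inequality for \<open>a\<close>, solved for the integer \<open>y k\<close>: the largest integer \<open>e\<close> such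
  that \<open>\<bar>a k\<bar> * e\<close> is at most the part of the form that is free of \<open>y k\<close>, where that part is
  first lowered by one if the perturbation makes the inequality strict. It is the upper bound
  for \<open>y k\<close> if \<open>a k < 0\<close>, and its negative is the lower bound if \<open>a k > 0\<close>.
\<close>
definition perturbed_bound :: "nat set \<Rightarrow> (nat \<Rightarrow> real) \<Rightarrow> nat \<Rightarrow> (nat \<Rightarrow> int) \<Rightarrow> (nat \<Rightarrow> int) \<Rightarrow> int" where
  "perturbed_bound I v k a y = (lin I a (y(k := 0)) + of_bool (lin I a v > 0) - 1) div \<bar>a k\<bar>"

lemma perturbed_pos_iff_int: "perturbed_pos I v a y \<longleftrightarrow> 1 \<le> lin I a y + of_bool (lin I a v > 0)"
  by (auto simp: perturbed_pos_def)

lemma le_div_iff: "(c::int) > 0 \<Longrightarrow> x \<le> n div c \<longleftrightarrow> c * x \<le> n"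
  by (metis div_mult_self1_is_m mult.commute nonzero_mult_div_cancel_left order_less_irrefl
    zdiv_mono1 mult_le_cancel_left_pos
     order_trans pos_mod_sign mult_div_mod_eq le_add_same_cancel1)

lemma perturbed_pos_lower_iff:
  assumes "finite I" "k \<in> I" "a k > 0"
  shows "perturbed_pos I v a (y(k := x)) \<longleftrightarrow> - perturbed_bound I v k a y \<le> x"
proof -
  have "- perturbed_bound I v k a y \<le> x \<longleftrightarrow> - x \<le> perturbed_bound I v k a y" by auto
  also have "\<dots> \<longleftrightarrow> a k * (- x) \<le> lin I a (y(k := 0)) + of_bool (lin I a v > 0) - 1"
    unfolding perturbed_bound_def using assms by (simp add: le_div_iff)
  also have "\<dots> \<longleftrightarrow> perturbed_pos I v a (y(k := x))"
    unfolding perturbed_pos_iff_int lin_upd[OF assms(1,2), of a y x] by auto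
  finally show ?thesis by simp
qed

lemma perturbed_pos_upper_iff:
  assumes "finite I" "k \<in> I" "a k < 0"
  shows "perturbed_pos I v a (y(k := x)) \<longleftrightarrow> x \<le> perturbed_bound I v k a y"
proof -
  have "x \<le> perturbed_bound I v k a y \<longleftrightarrow> - a k * x \<le> lin I a (y(k := 0)) + of_bool (lin I a v > 0) - 1"
    unfolding perturbed_bound_def using assms by (simp add: le_div_iff)
  also have "\<dots> \<longleftrightarrow> perturbed_pos I v a (y(k := x))"
    unfolding perturbed_pos_iff_int lin_upd[OF assms(1,2), of a y x] by auto
  finally show ?thesis by simp
qed

text \<open>
  The source of reciprocity: exchanging strict and weak inequalities while reflecting the
  lattice is the floor identity \<open>(- n - 1) div c = - (n div c) - 1\<close>.
\<close>
lemma perturbed_bound_reflect: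
  assumes "generic I v" "k \<in> I" "a k \<noteq> 0"
  shows "perturbed_bound I (\<lambda>i. - v i) k a y = - perturbed_bound I v k a (\<lambda>i. - y i) - 1"
proof -
  have "(\<lambda>i. - y i)(k := 0) = (\<lambda>i. - (y(k := 0)) i)" by auto
  then have l: "lin I a ((\<lambda>i. - y i)(k := 0)) = - lin I a (y(k := 0))"
    by (simp only: lin_uminus_arg)
  have "lin I a v \<noteq> 0" using assms by (auto simp: generic_def)
  then have s: "of_bool (lin I a (\<lambda>i. - v i) > 0) = 1 - (of_bool (lin I a v > 0) :: int)"
    by (auto simp: lin_uminus_arg)
  have d: "(- n - 1) div c = - 1 - n div c" if "c > 0" for n c :: int
  proof -
    have "(- n - 1) div c = (c * (- 1 - n div c) + (c - 1 - n mod c)) div c"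
      by (rule arg_cong[of _ _ "\<lambda>x. x div c"]) (simp add: algebra_simps minus_mod_eq_mult_div[symmetric])
    also have "\<dots> = - 1 - n div c + (c - 1 - n mod c) div c" using that by simp
    also have "(c - 1 - n mod c) div c = 0"
      using pos_mod_bound[OF that, of n] pos_mod_sign[OF that, of n]
        by (intro div_pos_pos_trivial) linarith+
    finally show ?thesis by simp
  qed
  show ?thesis unfolding perturbed_bound_def l s
    using d[of "\<bar>a k\<bar>" "lin I a (y(k := 0)) - of_bool (lin I a v > 0)"] assms
      by (simp add: algebra_simps)
qed

text \<open>
  The form \<open>\<bar>b k\<bar> a + \<bar>a k\<bar> b\<close> is free of \<open>y k\<close> and says that the real lower bound from \<open>a\<close>
  lies below the real upper bound from \<open>b\<close>. The integers between the two bounds may still be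
  missing, but then the range is empty in the only form that telescoping allows.
\<close>
lemma perturbed_bounds_consistent:
  assumes "finite I" "k \<in> I" "a k > 0" "b k < 0"
    and f: "perturbed_pos I v (\<lambda>i. \<bar>b k\<bar> * a i + \<bar>a k\<bar> * b i) y"
  shows "- perturbed_bound I v k a y - 1 \<le> perturbed_bound I v k b y"
proof (rule ccontr)
  define c d where "c = a k" and "d = - b k"
  have cd: "c > 0" "d > 0" using assms by (auto simp: c_def d_def)
  let ?A = "lin I a v" and ?B = "lin I b v"
  let ?l = "lin I a (y(k := 0))" and ?u = "lin I b (y(k := 0))"
  let ?p = "perturbed_bound I v k a y" and ?q = "perturbed_bound I v k b y"
  assume "\<not> ?thesis"
  then have le: "?p + ?q + 2 \<le> 0" by simp
  have *: "n < c * (n div c + 1)" if "c > 0" for n c :: int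
    using pos_mod_bound[OF that, of n] mult_div_mod_eq[of c n] unfolding distrib_left by linarith
  have p: "?l + of_bool (?A > 0) \<le> c * (?p + 1)"
    using *[OF cd(1), of "?l + of_bool (?A > 0) - 1"] cd unfolding perturbed_bound_def c_def by simp
  have q: "?u + of_bool (?B > 0) \<le> d * (?q + 1)"
    using *[OF cd(2), of "?u + of_bool (?B > 0) - 1"] cd unfolding perturbed_bound_def d_def by simp
  have "d * (?l + of_bool (?A > 0)) + c * (?u + of_bool (?B > 0)) \<le> d * (c * (?p + 1)) +
    c * (d * (?q + 1))"
    using p q cd by (intro add_mono mult_left_mono) auto
  also have "\<dots> = (c * d) * (?p + ?q + 2)" by (simp add: algebra_simps)
  also have "\<dots> \<le> 0" using le cd by (simp add: mult_nonneg_nonpos)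
  finally have 1: "d * ?l + c * ?u + (d * of_bool (?A > 0) + c * of_bool (?B > 0)) \<le> 0"
    by (simp add: algebra_simps)
  have ly: "lin I a y = ?l + c * y k" "lin I b y = ?u - d * y k"
    using lin_upd[OF assms(1,2), of a y "y k"] lin_upd[OF assms(1,2), of b y "y k"]
    by (simp_all add: c_def d_def)
  have "lin I (\<lambda>i. \<bar>b k\<bar> * a i + \<bar>a k\<bar> * b i) y = d * lin I a y + c * lin I b y"
    unfolding lin_add lin_scale using cd by (simp add: c_def d_def)
  then have "lin I (\<lambda>i. \<bar>b k\<bar> * a i + \<bar>a k\<bar> * b i) y = d * ?l + c * ?u"
    unfolding ly by (simp add: algebra_simps)
  moreover have "lin I (\<lambda>i. \<bar>b k\<bar> * a i + \<bar>a k\<bar> * b i) v = real_of_int d * ?A + real_of_int c * ?B"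
    unfolding lin_add lin_scale using cd by (simp add: c_def d_def)
  ultimately have 2: "1 \<le> d * ?l + c * ?u + of_bool (real_of_int d * ?A + real_of_int c * ?B > 0)"
    using f unfolding perturbed_pos_iff_int by simp
  show False
  proof (cases "?A > 0 \<or> ?B > 0")
    case True
    then have "d * of_bool (?A > 0) + c * of_bool (?B > 0) \<ge> 1" using cd by auto
    moreover have "of_bool (real_of_int d * ?A + real_of_int c * ?B > 0) \<le> (1 :: int)" by simp
    ultimately show False using 1 2 by linarith
  next
    case False
    then have "real_of_int d * ?A + real_of_int c * ?B \<le> 0"
      using cd by (intro add_nonpos_nonpos mult_nonneg_nonpos) auto
    with 1 2 False show False by auto
  qed
qed

text \<open>
  The second part makes the bound fit for substitution into functions of residues: it is
  determined modulo \<open>N\<close> by the coordinates modulo \<open>N * \<bar>a k\<bar>\<close>.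
\<close>
lemma qpoly_perturbed_bound:
  assumes "finite I" "k \<in> I" "a k \<noteq> 0"
  shows "qpoly (\<lambda>y. of_int (perturbed_bound I v k a y))"
    and "N > 0 \<Longrightarrow> (\<And>i. y i mod (N * \<bar>a k\<bar>) = y' i mod (N * \<bar>a k\<bar>)) \<Longrightarrow>
      perturbed_bound I v k a y mod N = perturbed_bound I v k a y' mod N"
proof -
  define c where "c = \<bar>a k\<bar>"
  have c: "c > 0" using assms by (simp add: c_def)
  define n where "n y = lin I a (y(k := 0)) + of_bool (lin I a v > 0) - 1" for y :: "nat \<Rightarrow> int"
  have n_mod: "n y mod M = n y' mod M" if "\<And>i. y i mod M = y' i mod M" for M y y'
  proof -
    have "(\<Sum>i\<in>I. a i * (y(k := 0)) i) mod M = (\<Sum>i\<in>I. a i * (y'(k := 0)) i) mod M"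
    proof -
      have "(a i * (y(k := 0)) i) mod M = (a i * (y'(k := 0)) i) mod M" for i
        using that[of i] by (cases "i = k") (auto intro: mod_mult_cong)
      then show ?thesis by (metis (mono_tags, lifting) mod_sum_eq sum.cong)
    qed
    then show ?thesis unfolding n_def lin_def of_int_eq_id id_apply
      by (intro mod_diff_cong mod_add_cong refl)
  qed
  have n_qpoly: "qpoly (\<lambda>y. of_int (n y))"
  proof -
    have "qpoly (\<lambda>y. (\<Sum>i\<in>I. of_int (a i) * (if i =
      k then 0 else of_int (y i))) + (of_bool (lin I a v > 0) - 1))"
    proof (intro qpoly.add qpoly_sum qpoly.mult qpoly_const assms)
      show "qpoly (\<lambda>y. if i = k then 0 else of_int (y i))" for i
        by (cases "i = k") (auto intro: qpoly_const qpoly.coord)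
    qed
    moreover have "(\<Sum>i\<in>I. of_int (a i) * (if i =
      k then 0 else of_int (y i))) + (of_bool (lin I a v > 0) - 1)
       = real_of_int (n y)" for y
      unfolding n_def lin_def by (auto simp: of_int_sum intro!: sum.cong)
    ultimately show ?thesis by simp
  qed
  have perturbed_bound: "perturbed_bound I v k a y = n y div c" for y
    by (simp add: perturbed_bound_def n_def c_def)
  have "qpoly (\<lambda>y. of_int (n y mod c))"
  proof (rule qpoly.residue[OF c])
    fix y y' :: "nat \<Rightarrow> int" assume "\<And>i. y i mod c = y' i mod c"
    then have "n y mod c = n y' mod c" by (rule n_mod)
    then show "real_of_int (n y mod c) = real_of_int (n y' mod c)" by simp
  qed
  then have "qpoly (\<lambda>y. (1 / of_int c) * (of_int (n y) - of_int (n y mod c)))"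
    by (rule qpoly.mult[OF qpoly_const qpoly_diff[OF n_qpoly]])
  moreover have "(1 / of_int c) * (of_int (n y) - of_int (n y mod c)) = real_of_int (n y div c)" for y
  proof -
    have "real_of_int (n y) = of_int c * of_int (n y div c) + of_int (n y mod c)"
      by (metis mult_div_mod_eq of_int_add of_int_mult)
    then show ?thesis using c by (simp add: field_simps)
  qed
  ultimately show "qpoly (\<lambda>y. of_int (perturbed_bound I v k a y))" by (simp add: perturbed_bound)
  show "perturbed_bound I v k a y mod N = perturbed_bound I v k a y' mod N"
    if "N > 0" "\<And>i. y i mod (N * \<bar>a k\<bar>) = y' i mod (N * \<bar>a k\<bar>)"
  proof -
    have eq: "n y mod (N * c) = n y' mod (N * c)" by (rule n_mod) (use that(2) in \<open>simp add: c_def\<close>)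
    have mod: "(x div c) mod N = (x mod (N * c)) div c" for x
    proof -
      have "x mod (N * c) = c * (x div c mod N) + x mod c"
        using zmod_zmult2_eq[of N x c] that(1) by (simp add: mult.commute)
      then show ?thesis using c by simp
    qed
    show ?thesis unfolding perturbed_bound mod eq ..
  qed
qed

lemma qpoly_subst:
  assumes "qpoly q" "qpoly (\<lambda>y. of_int (e y))"
    and e: "\<And>N. N > 0 \<Longrightarrow> \<exists>M>0. \<forall>y y'. (\<forall>i. y i mod M = y' i mod M) \<longrightarrow> e y mod N = e y' mod (N::int)"
  shows "qpoly (\<lambda>y. q (y(k := e y)))"
  using assms(1)
proof induction
  case (coord i)
  show ?case using assms(2) qpoly.coord[of i] by (cases "i = k") auto
next
  case (residue N g)
  obtain M where M: "M > 0" "\<And>y y'. (\<forall>i. y i mod M = y' i mod M) \<Longrightarrow> e y mod N = e y' mod N"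
    using e[OF residue(1)] by blast
  show ?case
  proof (rule qpoly.residue[of "M * N"])
    \<comment> \<open>the product \<open>M * N\<close> controls the residues modulo \<open>N\<close> of all coordinates, and
      through \<open>M\<close> that of the substituted one\<close>
    show "M * N > 0" using M residue by simp
    fix y y' :: "nat \<Rightarrow> int" assume eq: "\<And>i. y i mod (M * N) = y' i mod (M * N)"
    have "y i mod M = y' i mod M" "y i mod N = y' i mod N" for i
      using arg_cong[OF eq[of i], of "\<lambda>x. x mod M"] arg_cong[OF eq[of i], of "\<lambda>x. x mod N"]
      by (simp_all add: mod_mod_cancel)
    then show "g (y(k := e y)) = g (y'(k := e y'))" using M(2) by (intro residue(2)) auto
  qed
qed (auto intro: qpoly.add qpoly.mult)

lemma qpoly_subst_perturbed_bound:
  assumes "finite I" "k \<in> I" "a k \<noteq> 0" "qpoly q"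
  shows "qpoly (\<lambda>y. q (y(k := perturbed_bound I v k a y)))" "qpoly (\<lambda>y. q (y(k := - perturbed_bound
    I v k a y - 1)))"
proof -
  have e: "\<exists>M>0. \<forall>y y'. (\<forall>i. y i mod M = y' i mod M) \<longrightarrow> perturbed_bound I v k a y mod N =
    perturbed_bound I v k a y' mod N"
    if "N > 0" for N
  proof (rule exI[of _ "N * \<bar>a k\<bar>"], intro conjI allI impI)
    show "0 < N * \<bar>a k\<bar>" using that assms(3) by simp
    fix y y' :: "nat \<Rightarrow> int" assume eq: "\<forall>i. y i mod (N * \<bar>a k\<bar>) = y' i mod (N * \<bar>a k\<bar>)"
    show "perturbed_bound I v k a y mod N = perturbed_bound I v k a y' mod N"
      by (rule qpoly_perturbed_bound(2)[where a=a and k=k and N=N, OF assms(1-3) that]) (rule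
        eq[rule_format])
  qed
  show "qpoly (\<lambda>y. q (y(k := perturbed_bound I v k a y)))"
    by (rule qpoly_subst[OF assms(4) qpoly_perturbed_bound(1)[where a=a and k=k, OF assms(1-3)] e])
  show "qpoly (\<lambda>y. q (y(k := - perturbed_bound I v k a y - 1)))"
  proof (rule qpoly_subst[OF assms(4)])
    have "qpoly (\<lambda>y. (-1) * of_int (perturbed_bound I v k a y) - 1)"
      by (intro qpoly_diff qpoly.mult qpoly_const qpoly_perturbed_bound(1)[where a=a and k=k, OF
        assms(1-3)])
    then show "qpoly (\<lambda>y. of_int (- perturbed_bound I v k a y - 1))" by simp
    fix N :: int assume "N > 0"
    from e[OF this] obtain M where "M > 0"
      "\<And>y y'. (\<forall>i. y i mod M = y' i mod M) \<Longrightarrow> perturbed_bound I v k a y mod N =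
        perturbed_bound I v k a y' mod N" by blast
    then show "\<exists>M>0. \<forall>y y'. (\<forall>i. y i mod M = y' i mod M) \<longrightarrow>
        (- perturbed_bound I v k a y - 1) mod N = (- perturbed_bound I v k a y' - 1) mod N"
      by (intro exI[of _ M] conjI allI impI mod_diff_cong mod_minus_cong) auto
  qed
qed

text \<open>
  Going from the first function of a pair to the second exchanges strict and weak inequalities
  and reflects the quasipolynomial in each term, which is how the two sides of reciprocity are
  related. The set \<open>E\<close> lists the variables that have been summed out and no longer occur in
  the inequalities.
\<close>
inductive reciprocal_pair :: "nat set \<Rightarrow> (nat \<Rightarrow> real) \<Rightarrow> nat set \<Rightarrow>
    ((nat \<Rightarrow> int) \<Rightarrow> real) \<Rightarrow> ((nat \<Rightarrow> int) \<Rightarrow> real) \<Rightarrow> bool" for I v E where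
  gen: "finite B \<Longrightarrow> (\<And>a i. a \<in> B \<Longrightarrow> i \<in> E \<Longrightarrow> a i = 0) \<Longrightarrow> qpoly q \<Longrightarrow>
    reciprocal_pair I v E (\<lambda>y. of_bool (perturbed_cone I v B y) * q y)
      (\<lambda>y. of_bool (perturbed_cone I (\<lambda>i. - v i) B y) * q (\<lambda>i. - y i))"
| add: "reciprocal_pair I v E F G \<Longrightarrow> reciprocal_pair I v E F' G' \<Longrightarrow>
  reciprocal_pair I v E (\<lambda>y. F y + F' y) (\<lambda>y. G y + G' y)"

definition fiber :: "nat set \<Rightarrow> (nat \<Rightarrow> real) \<Rightarrow> nat \<Rightarrow> (nat \<Rightarrow> int) set \<Rightarrow> (nat \<Rightarrow> int) \<Rightarrow> int set" where
  "fiber I v k B y = {x. perturbed_cone I v B (y(k := x))}"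

lemma finite_fiber:
  assumes "finite I" "k \<in> I" "a \<in> B" "a k > 0" "b \<in> B" "b k < 0"
  shows "finite (fiber I v k B y)"
proof (rule finite_subset)
  show "fiber I v k B y \<subseteq> {- perturbed_bound I v k a y .. perturbed_bound I v k b y}"
    using assms(3,5) by (auto simp: fiber_def perturbed_cone_def perturbed_pos_lower_iff[where a=a,
      OF assms(1,2,4), symmetric]
        perturbed_pos_upper_iff[where a=b, OF assms(1,2,6), symmetric])
qed simp

text \<open>
  With a single lower bound \<open>a\<close> and a single upper bound \<open>b\<close> the fiber is an interval, and it
  telescopes. For \<open>- v\<close> and \<open>- y\<close> the two end points trade places up to the shift by one, so
  the same quasipolynomial appears with the opposite sign.
\<close>
lemma reciprocal_pair_sum_interval:
  assumes gen: "generic I v" and k: "k \<in> I" "k \<notin> E" and B0: "finite B0"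
    "\<And>a i. a \<in> B0 \<Longrightarrow> i \<in> insert k E \<Longrightarrow> a i = 0"
    and ab: "a k > 0" "b k < 0" "\<And>i. i \<in> E \<Longrightarrow> a i = 0" "\<And>i. i \<in> E \<Longrightarrow> b i = 0"
    and q: "qpoly q" and B: "B = insert a (insert b B0)"
  shows "reciprocal_pair I v (insert k E) (\<lambda>y. \<Sum>x\<in>fiber I v k B y. q (y(k := x)))
     (\<lambda>y. - (\<Sum>x\<in>fiber I (\<lambda>i. - v i) k B y. q (\<lambda>i. - (y(k := x)) i)))"
proof -
  define f where "f = (\<lambda>i. \<bar>b k\<bar> * a i + \<bar>a k\<bar> * b i)"
  obtain Q where Q: "qpoly Q" "\<And>y. Q y - Q (y(k := y k - 1)) = q y"
    using qpoly_antidifference[OF q] by metis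
  have I: "finite I" using gen by (simp add: generic_def)
  define w where "w = (\<lambda>i. - v i)"
  \<comment> \<open>the sum over the interval with end points \<open>- perturbed_bound a\<close> and
    \<open>perturbed_bound b\<close>, as a function of the remaining variables\<close>
  define R where "R y = Q (y(k := perturbed_bound I v k b y)) - Q (y(k := - perturbed_bound I v k a
    y - 1))" for y
  have R: "qpoly R" unfolding R_def using ab by (intro qpoly_diff qpoly_subst_perturbed_bound I k Q) auto
  have fib: "fiber I u k B y =
    (if perturbed_cone I u (insert f B0) y then {- perturbed_bound I u k a y .. perturbed_bound I u
      k b y} else {})" for u y
  proof -
    have "perturbed_cone I u B (y(k := x)) \<longleftrightarrow>
      perturbed_cone I u (insert f B0) y \<and> - perturbed_bound I u k a y \<le> x \<and> x \<le> perturbed_bound I u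
        k b y" for x
    proof -
      have "perturbed_pos I u f (y(k := x))" if "perturbed_pos I u a (y(k := x))" "perturbed_pos I u
        b (y(k := x))"
        unfolding f_def using that ab by (intro perturbed_pos_comb) auto
      moreover have "f k = 0" using ab by (simp add: f_def)
      ultimately show ?thesis
        using B0(2) perturbed_pos_lower_iff[where a=a, OF I k(1) ab(1), of u y x]
          perturbed_pos_upper_iff[where a=b, OF I k(1) ab(2), of u y x]
        by (simp add: B perturbed_cone_def perturbed_pos_upd_irrelevant) blast
    qed
    then show ?thesis
      by (cases "perturbed_cone I u (insert f B0) y") (simp_all add: fiber_def atLeastAtMost_def
        atLeast_def atMost_def Collect_conj_eq)
  qed
  have cons: "- perturbed_bound I u k a y - 1 \<le> perturbed_bound I u k b y" if "perturbed_cone I u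
    (insert f B0) y" for u y
    using that ab by (intro perturbed_bounds_consistent I k) (auto simp: perturbed_cone_def f_def)
  have v: "(\<Sum>x\<in>fiber I v k B y. q (y(k := x))) =
    of_bool (perturbed_cone I v (insert f B0) y) * R y" for y
    using qpoly_antidifference_sum[where Q=Q and k=k and q=q and y=y, OF Q(2) cons[of v y]]
      by (simp add: fib R_def)
  have w: "- (\<Sum>x\<in>fiber I w k B y. q (\<lambda>i. - (y(k := x)) i)) =
      of_bool (perturbed_cone I w (insert f B0) y) * R (\<lambda>i. - y i)" for y
  proof (cases "perturbed_cone I w (insert f B0) y")
    case True
    let ?y = "\<lambda>i. - y i"
    have r: "perturbed_bound I w k a y =
      - perturbed_bound I v k a ?y - 1" "perturbed_bound I w k b y = - perturbed_bound I v k b ?y - 1"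
      unfolding w_def using ab by (auto intro!: perturbed_bound_reflect gen k)
    have upd: "(\<lambda>i. - (y(k := x)) i) = ?y(k := - x)" for x by auto
    have "(\<Sum>x\<in>fiber I w k B y. q (\<lambda>i. - (y(k := x)) i)) =
      (\<Sum>x\<in>{- perturbed_bound I w k a y..perturbed_bound I w k b y}. q (?y(k := - x)))"
      unfolding upd using True by (simp add: fib)
    also have "\<dots> = (\<Sum>x\<in>{- perturbed_bound I w k b y..perturbed_bound I w k a y}. q (?y(k := x)))"
      by (rule sum.reindex_bij_witness[of _ uminus uminus]) auto
    also have "\<dots> = Q (?y(k := perturbed_bound I w k a y)) - Q (?y(k := - perturbed_bound I w k b y - 1))"
      by (rule qpoly_antidifference_sum[where Q=Q and k=k and q=q, OF Q(2)]) (use cons[OF True] in simp)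
    also have "\<dots> = - R ?y" by (simp add: R_def r)
    finally show ?thesis using True by simp
  qed (simp add: fib)
  have "reciprocal_pair I v (insert k E) (\<lambda>y. of_bool (perturbed_cone I v (insert f B0) y) * R y)
      (\<lambda>y. of_bool (perturbed_cone I w (insert f B0) y) * R (\<lambda>i. - y i))"
    unfolding w_def by (rule reciprocal_pair.gen) (use B0 R ab in \<open>auto simp: f_def\<close>)
  then show ?thesis unfolding v w[symmetric] unfolding w_def .
qed

text \<open>
  Induction on the number of inequalities that involve \<open>y k\<close>. Two bounds \<open>a\<close>, \<open>b\<close> of the same
  kind are compared by the form \<open>f = \<bar>b k\<bar> a - \<bar>a k\<bar> b\<close>, which is free of \<open>y k\<close>: on either
  side of its hyperplane one of the two is redundant, and genericity puts every perturbed
  lattice point on exactly one side. One lower and one upper bound always survive, which keeps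
  the fibers finite.
\<close>
lemma reciprocal_pair_sum_fiber:
  assumes gen: "generic I v" and k: "k \<in> I" "k \<notin> E" and q: "qpoly q"
  shows "finite B \<Longrightarrow> (\<And>a i. a \<in> B \<Longrightarrow> i \<in> E \<Longrightarrow> a i = 0) \<Longrightarrow> \<exists>a\<in>B. a k > 0 \<Longrightarrow> \<exists>b\<in>B. b k < 0 \<Longrightarrow>
    reciprocal_pair I v (insert k E) (\<lambda>y. \<Sum>x\<in>fiber I v k B y. q (y(k := x)))
     (\<lambda>y. - (\<Sum>x\<in>fiber I (\<lambda>i. - v i) k B y. q (\<lambda>i. - (y(k := x)) i)))"
proof (induction "card {a \<in> B. a k \<noteq> 0}" arbitrary: B rule: less_induct)
  case less
  have I: "finite I" using gen by (simp add: generic_def)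
  define w where "w = (\<lambda>i. - v i)"
  show ?case
  proof (cases "\<exists>a\<in>B. \<exists>b\<in>B. a \<noteq> b \<and> a k * b k > 0")
    case False
    obtain a b where ab: "a \<in> B" "a k > 0" "b \<in> B" "b k < 0" using less by blast
    define B0 where "B0 = {c \<in> B. c k = 0}"
    have "B \<subseteq> insert a (insert b B0)"
    proof
      fix c assume c: "c \<in> B"
      show "c \<in> insert a (insert b B0)"
      proof (cases "c k" "0::int" rule: linorder_cases)
        case less
        then have "c k * b k > 0" using ab by (simp add: mult_neg_neg)
        then show ?thesis using False c ab by auto
      next
        case equal then show ?thesis using c by (simp add: B0_def)
      next
        case greater
        then have "c k * a k > 0" using ab by simp
        then show ?thesis using False c ab by auto
      qed
    qed
    then have "B = insert a (insert b B0)" using ab by (auto simp: B0_def)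
    moreover have "finite B0" using less by (simp add: B0_def)
    ultimately show ?thesis using less.prems ab k q
      by (intro reciprocal_pair_sum_interval[OF gen]) (auto simp: B0_def)
  next
    case True
    then obtain a b where ab: "a \<in> B" "b \<in> B" "a \<noteq> b" "a k * b k > 0" by blast
    define f where "f = (\<lambda>i. \<bar>b k\<bar> * a i - \<bar>a k\<bar> * b i)"
    have nz: "\<bar>a k\<bar> > 0" "\<bar>b k\<bar> > 0" using ab by auto
    have fk: "f k = 0" using ab by (auto simp: f_def abs_if zero_less_mult_iff)
    have pos_a: "perturbed_pos I u a y" if "perturbed_pos I u b y" "perturbed_pos I u f y" for u y
    proof -
      have "perturbed_pos I u (\<lambda>i. \<bar>a k\<bar> * b i + 1 * f i) y" using that nz
        by (intro perturbed_pos_comb) auto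
      then have "perturbed_pos I u (\<lambda>i. \<bar>b k\<bar> * a i) y" by (simp add: f_def)
      then show ?thesis using perturbed_pos_scale[OF nz(2)] by blast
    qed
    have pos_b: "perturbed_pos I u b y" if "perturbed_pos I u a y" "perturbed_pos I u (\<lambda>i. - f i) y"
      for u y
    proof -
      have "perturbed_pos I u (\<lambda>i. \<bar>b k\<bar> * a i + 1 * - f i) y" using that nz
        by (intro perturbed_pos_comb) auto
      then have "perturbed_pos I u (\<lambda>i. \<bar>a k\<bar> * b i) y" by (simp add: f_def)
      then show ?thesis using perturbed_pos_scale[OF nz(1)] by blast
    qed
    have fE: "f i = 0" if "i \<in> E" for i using less.prems(2)[OF ab(1) that] less.prems(2)[OF ab(2) that]
      by (simp add: f_def)
    have card1: "card {c \<in> insert g (B - {e}). c k \<noteq> 0} < card {a \<in> B. a k \<noteq> 0}" if "g k =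
      0" "e \<in> {a, b}" for g e
    proof (rule psubset_card_mono)
      show "finite {a \<in> B. a k \<noteq> 0}" using less.prems(1) by simp
      have "{c \<in> insert g (B - {e}). c k \<noteq> 0} = {a \<in> B. a k \<noteq> 0} - {e}" using that(1) by auto
      moreover have "e \<in> {a \<in> B. a k \<noteq> 0}" using that(2) ab nz by auto
      ultimately show "{c \<in> insert g (B - {e}). c k \<noteq> 0} \<subset> {a \<in> B. a k \<noteq> 0}" by blast
    qed
    have signs: "\<exists>c\<in>B - {e}. c k > 0" "\<exists>c\<in>B - {e}. c k < 0" if "e \<in> {a, b}" for e
    proof -
      obtain c where c: "c \<in> B" "c k > 0" using less.prems by blast
      show "\<exists>c\<in>B - {e}. c k > 0"
        using c ab that by (cases "c = e") (auto simp: zero_less_mult_iff)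
      obtain c where c: "c \<in> B" "c k < 0" using less.prems by blast
      show "\<exists>c\<in>B - {e}. c k < 0"
        using c ab that by (cases "c = e") (auto simp: zero_less_mult_iff)
    qed
    show ?thesis
    proof (cases "\<exists>i\<in>I. f i \<noteq> 0")
      case False
      have eq: "perturbed_cone I u B y = perturbed_cone I u (B - {a}) y" for u y
      proof -
        have "perturbed_pos I u a y" if "perturbed_pos I u b y"
        proof -
          have "perturbed_pos I u (\<lambda>i. \<bar>b k\<bar> * a i) y = perturbed_pos I u (\<lambda>i. \<bar>a k\<bar> * b i) y"
            using False by (intro perturbed_pos_cong) (auto simp: f_def)
          then show ?thesis using that perturbed_pos_scale nz by blast
        qed
        then show ?thesis using ab by (auto simp: perturbed_cone_def)
      qed
      have fib: "fiber I u k B y = fiber I u k (B - {a}) y" for u y unfolding fiber_def eq ..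
      have "card {c \<in> B - {a}. c k \<noteq> 0} < card {a \<in> B. a k \<noteq> 0}"
      proof (rule psubset_card_mono)
        show "finite {a \<in> B. a k \<noteq> 0}" using less.prems(1) by simp
        have "a \<in> {a \<in> B. a k \<noteq> 0}" using ab nz by auto
        then show "{c \<in> B - {a}. c k \<noteq> 0} \<subset> {a \<in> B. a k \<noteq> 0}" by blast
      qed
      then show ?thesis unfolding fib
        by (rule less.hyps) (use less.prems signs[of a] in auto)
    next
      case True
      define B1 where "B1 = insert f (B - {a})"
      define B2 where "B2 = insert (\<lambda>i. - f i) (B - {b})"
      have cone1: "perturbed_cone I u B1 y \<longleftrightarrow> perturbed_cone I u B y \<and> perturbed_pos I u f y" for u y
        using ab pos_a by (auto simp: perturbed_cone_def B1_def)
      have cone2: "perturbed_cone I u B2 y \<longleftrightarrow>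
        perturbed_cone I u B y \<and> perturbed_pos I u (\<lambda>i. - f i) y" for u y
        using ab pos_b by (auto simp: perturbed_cone_def B2_def)
      have split: "(\<Sum>x\<in>fiber I u k B y. h x) = (\<Sum>x\<in>fiber I u k B1 y. h x) + (\<Sum>x\<in>fiber I u k B2 y. h x)"
        if "generic I u" for u y and h :: "int \<Rightarrow> real"
      proof -
        have "fiber I u k B y = fiber I u k B1 y \<union> fiber I u k B2 y" "fiber I u k B1 y \<inter> fiber I u k
          B2 y = {}"
          using perturbed_pos_neg_iff[OF that True] by (auto simp: fiber_def cone1 cone2)
        moreover have "finite (fiber I u k B y)"
          using less.prems finite_fiber[OF I k(1)] by blast
        ultimately show ?thesis by (simp add: sum.union_disjoint)
      qed
      have r1: "reciprocal_pair I v (insert k E) (\<lambda>y. \<Sum>x\<in>fiber I v k B1 y. q (y(k := x)))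
         (\<lambda>y. - (\<Sum>x\<in>fiber I w k B1 y. q (\<lambda>i. - (y(k := x)) i)))"
        unfolding w_def
      proof (rule less.hyps)
        show "card {c \<in> B1. c k \<noteq> 0} < card {a \<in> B. a k \<noteq> 0}" unfolding B1_def
          by (rule card1) (auto simp: fk)
      qed (use less.prems signs[of a] fE in \<open>auto simp: B1_def\<close>)
      have r2: "reciprocal_pair I v (insert k E) (\<lambda>y. \<Sum>x\<in>fiber I v k B2 y. q (y(k := x)))
         (\<lambda>y. - (\<Sum>x\<in>fiber I w k B2 y. q (\<lambda>i. - (y(k := x)) i)))"
        unfolding w_def
      proof (rule less.hyps)
        show "card {c \<in> B2. c k \<noteq> 0} < card {a \<in> B. a k \<noteq> 0}" unfolding B2_def
          by (rule card1) (auto simp: fk)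
      qed (use less.prems signs[of b] fE in \<open>auto simp: B2_def\<close>)
      show ?thesis
        using reciprocal_pair.add[OF r1 r2]
          unfolding w_def split[OF gen] split[OF generic_neg[OF gen]] by simp
    qed
  qed
qed

definition unit :: "nat \<Rightarrow> nat \<Rightarrow> int" where "unit j i = of_bool (i = j)"

lemma lin_unit: "finite I \<Longrightarrow> lin I (unit j) y = (if j \<in> I then y j else 0)"
  by (simp add: lin_def unit_def of_bool_def if_distrib[of "\<lambda>x. x * _"] if_distrib[of of_int] cong:
    if_cong)

text \<open>
  Adding the inequalities \<open>0 < y k < y h\<close> in perturbed form makes every fiber a finite set
  inside \<open>{0..y h}\<close>, so that \<open>reciprocal_pair_sum_fiber\<close> applies to each summand.
\<close>
lemma reciprocal_pair_sum_between:
  assumes gen: "generic I v" and k: "k \<in> I" "k \<notin> E" and h: "h \<in> I" "h \<notin> E" "h \<noteq> k"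
    and B: "B = {unit k, \<lambda>i. unit h i - unit k i}"
    and "reciprocal_pair I v E F G"
  shows "reciprocal_pair I v (insert k E)
     (\<lambda>y. \<Sum>x\<in>{0..y h}. of_bool (perturbed_cone I v B (y(k := x))) * F (y(k := x)))
     (\<lambda>y. - (\<Sum>x\<in>{0..y h}. of_bool (perturbed_cone I (\<lambda>i. - v i) B (y(k := x))) * G (y(k := x))))"
  using assms(8)
proof induction
  case (gen A q)
  have I: "finite I" using assms(1) by (simp add: generic_def)
  have sub: "fiber I u k (A \<union> B) y \<subseteq> {0..y h}" for u y
    using k h by (auto simp: fiber_def B perturbed_cone_def perturbed_pos_def lin_diff lin_unit I)
  have eq: "(\<Sum>x\<in>{0..y h}. of_bool (perturbed_cone I u B (y(k := x))) * (of_bool (perturbed_cone I u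
    A (y(k := x))) * p x)) =
      (\<Sum>x\<in>fiber I u k (A \<union> B) y. p x)" for u y and p :: "int \<Rightarrow> real"
  proof (rule sum.mono_neutral_cong_right)
    show "fiber I u k (A \<union> B) y \<subseteq> {0..y h}" by (rule sub)
  qed (auto simp: fiber_def perturbed_cone_def)
  have "reciprocal_pair I v (insert k E) (\<lambda>y. \<Sum>x\<in>fiber I v k (A \<union> B) y. q (y(k := x)))
     (\<lambda>y. - (\<Sum>x\<in>fiber I (\<lambda>i. - v i) k (A \<union> B) y. q (\<lambda>i. - (y(k := x)) i)))"
  proof (rule reciprocal_pair_sum_fiber[OF assms(1) k gen(3)])
    show "finite (A \<union> B)" using gen by (simp add: B)
    show "a i = 0" if "a \<in> A \<union> B" "i \<in> E" for a i
      using that gen(2)[of a i] k h by (auto simp: B unit_def)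
    show "\<exists>a\<in>A \<union> B. a k > 0" "\<exists>a\<in>A \<union> B. a k < 0"
      using h by (auto simp: B unit_def)
  qed
  then show ?case
    by (simp only: eq[of v y "\<lambda>x. q (y(k := x))" for y]
        eq[of "\<lambda>i. - v i" y "\<lambda>x. q (\<lambda>i. - (y(k := x)) i)" for y])
next
  case (add F G F' G')
  from reciprocal_pair.add[OF add.IH] show ?case by (simp add: sum.distrib distrib_left)
qed

section \<open>Reciprocity for lattice points of a cone\<close>

text \<open>
  The lattice points that satisfy \<open>P\<close> and agree with \<open>y\<close> outside the first \<open>k\<close> coordinates:
  what has been counted after \<open>k\<close> summations.
\<close>
definition slice :: "((nat \<Rightarrow> int) \<Rightarrow> bool) \<Rightarrow> nat \<Rightarrow> (nat \<Rightarrow> int) \<Rightarrow> (nat \<Rightarrow> int) set" where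
  "slice P k y = {x. (\<forall>i. i \<notin> {1..k} \<longrightarrow> x i = y i) \<and> P x}"

lemma slice_0: "slice P 0 y = (if P y then {y} else {})"
proof -
  have "(\<forall>i. x i = y i) \<longleftrightarrow> x = y" for x by auto
  then show ?thesis by (auto simp: slice_def)
qed

lemma slice_Suc:
  assumes "\<And>x. P x \<Longrightarrow> 0 \<le> x (Suc k) \<and> x (Suc k) \<le> x (Suc (Suc k))"
  shows "slice P (Suc k) y = (\<Union>x\<in>{0..y (Suc (Suc k))}. slice P k (y(Suc k := x)))"
proof (intro equalityI subsetI)
  fix x assume x: "x \<in> slice P (Suc k) y"
  then have "x (Suc (Suc k)) = y (Suc (Suc k))" "P x" by (auto simp: slice_def)
  then have "x (Suc k) \<in> {0..y (Suc (Suc k))}" using assms[of x] by simp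
  moreover have "x \<in> slice P k (y(Suc k := x (Suc k)))" using x by (auto simp: slice_def)
  ultimately show "x \<in> (\<Union>x\<in>{0..y (Suc (Suc k))}. slice P k (y(Suc k := x)))" by blast
next
  fix x assume "x \<in> (\<Union>x\<in>{0..y (Suc (Suc k))}. slice P k (y(Suc k := x)))"
  then obtain c where x: "x \<in> slice P k (y(Suc k := c))" by blast
  have "x i = y i" if "i \<notin> {1..Suc k}" for i
  proof -
    have "x i = (y(Suc k := c)) i" using x that by (auto simp: slice_def)
    then show ?thesis using that by auto
  qed
  then show "x \<in> slice P (Suc k) y" using x by (simp add: slice_def)
qed

lemma finite_slice:
  assumes "\<And>x i. P x \<Longrightarrow> 1 \<le> i \<Longrightarrow> i \<le> k \<Longrightarrow> 0 \<le> x i \<and> x i \<le> x (Suc i)"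
  shows "finite (slice P k y)"
  using assms
proof (induction k arbitrary: y)
  case (Suc k)
  show ?case
    by (subst slice_Suc) (use Suc.prems[of _ "Suc k"] in simp, intro finite_UN_I Suc.IH Suc.prems, auto)
qed (simp add: slice_0)

lemma card_slice_Suc:
  assumes "\<And>x i. P x \<Longrightarrow> 1 \<le> i \<Longrightarrow> i \<le> Suc k \<Longrightarrow> 0 \<le> x i \<and> x i \<le> x (Suc i)"
  shows "card (slice P (Suc k) y) = (\<Sum>x\<in>{0..y (Suc (Suc k))}. card (slice P k (y(Suc k := x))))"
proof (subst slice_Suc)
  show "card (\<Union>x\<in>{0..y (Suc (Suc k))}. slice P k (y(Suc k := x))) =
      (\<Sum>x\<in>{0..y (Suc (Suc k))}. card (slice P k (y(Suc k := x))))"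
  proof (rule card_UN_disjoint)
    show "\<forall>i\<in>{0..y (Suc (Suc k))}. finite (slice P k (y(Suc k := i)))"
      using finite_slice[of P k] assms by (meson le_Suc_eq)
  qed (auto simp: slice_def)
qed (use assms[of _ "Suc k"] in simp)

definition neighbour_forms :: "nat \<Rightarrow> (nat \<Rightarrow> int) set" where
  "neighbour_forms k = {unit k, \<lambda>i. unit (Suc k) i - unit k i}"

lemma perturbed_cone_neighbour_forms:
  assumes "perturbed_cone I v (neighbour_forms k) x" "finite I" "k \<in> I" "Suc k \<in> I"
  shows "0 \<le> x k \<and> x k \<le> x (Suc k)"
  using assms by (auto simp: neighbour_forms_def perturbed_cone_def perturbed_pos_def lin_diff lin_unit)

lemma reciprocal_pair_slice:
  assumes gen: "generic {1..m} v" and A: "finite A" "\<And>k. 1 \<le> k \<Longrightarrow> k < m \<Longrightarrow> neighbour_forms k \<subseteq> A"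
  shows "k < m \<Longrightarrow> reciprocal_pair {1..m} v {1..k} (\<lambda>y. real (card (slice (perturbed_cone {1..m} v A)
    k y)))
           (\<lambda>y. (-1) ^ k * real (card (slice (perturbed_cone {1..m} (\<lambda>i. - v i) A) k y)))"
proof (induction k)
  case 0
  show ?case using reciprocal_pair.gen[OF A(1) _ qpoly_const[of 1], of "{1..0}" "{1..m}" v]
    by (simp add: slice_0 of_bool_def if_distrib[of card] if_distrib[of real] cong: if_cong)
next
  case (Suc k)
  let ?B = "neighbour_forms (Suc k)"
  have IH: "reciprocal_pair {1..m} v {1..k} (\<lambda>y. real (card (slice (perturbed_cone {1..m} v A) k y)))
           (\<lambda>y. (-1) ^ k * real (card (slice (perturbed_cone {1..m} (\<lambda>i. - v i) A) k y)))"
    using Suc by simp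
  have step: "(\<Sum>x\<in>{0..y (Suc (Suc k))}. of_bool (perturbed_cone {1..m} u ?B (y(Suc k := x))) * (c *
    card (slice (perturbed_cone {1..m} u A) k (y(Suc k := x)))))
     = c * card (slice (perturbed_cone {1..m} u A) (Suc k) y)" for u y and c :: real
  proof -
    have le: "0 \<le> x i \<and> x i \<le> x (Suc i)" if "perturbed_cone {1..m} u A x" "1 \<le> i" "i \<le> Suc k" for x i
    proof (rule perturbed_cone_neighbour_forms)
      show "perturbed_cone {1..m} u (neighbour_forms i) x" using that A(2)[of i] Suc.prems
        by (auto simp: perturbed_cone_def)
    qed (use that Suc.prems in auto)
    have "of_bool (perturbed_cone {1..m} u ?B (y(Suc k := x))) * (c * card (slice (perturbed_cone
      {1..m} u A) k (y(Suc k := x))))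
       = c * real (card (slice (perturbed_cone {1..m} u A) k (y(Suc k := x))))" for x
    \<comment> \<open>values outside the bounds contribute nothing, because the inequalities in \<open>A\<close>
      include the bounds\<close>
    proof (cases "perturbed_cone {1..m} u ?B (y(Suc k := x))")
      case False
      have "slice (perturbed_cone {1..m} u A) k (y(Suc k := x)) = {}"
      proof -
        have "perturbed_cone {1..m} u ?B (y(Suc k := x))" if z: "z \<in> slice (perturbed_cone {1..m} u
          A) k (y(Suc k := x))" for z
        proof -
          have "perturbed_cone {1..m} u ?B z" using z A(2)[of "Suc k"] Suc.prems
            by (auto simp: slice_def perturbed_cone_def)
          moreover have "z (Suc k) = x" "z (Suc (Suc k)) = y (Suc (Suc k))" using z
            by (auto simp: slice_def)
          ultimately show ?thesis using Suc.prems
            by (auto simp: neighbour_forms_def perturbed_cone_def perturbed_pos_def lin_diff lin_unit)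
        qed
        then show ?thesis using False by blast
      qed
      then show ?thesis by simp
    qed simp
    then have "(\<Sum>x\<in>{0..y (Suc (Suc k))}. of_bool (perturbed_cone {1..m} u ?B (y(Suc k := x))) * (c *
      card (slice (perturbed_cone {1..m} u A) k (y(Suc k := x)))))
       = (\<Sum>x\<in>{0..y (Suc (Suc k))}. c * real (card (slice (perturbed_cone {1..m} u A) k (y(Suc k :=
         x)))))"
      by (intro sum.cong refl)
    also have "\<dots> = c * card (slice (perturbed_cone {1..m} u A) (Suc k) y)"
      by (subst card_slice_Suc[OF le]) (simp_all add: sum_distrib_left)
    finally show ?thesis .
  qed
  have "reciprocal_pair {1..m} v (insert (Suc k) {1..k})
     (\<lambda>y. \<Sum>x\<in>{0..y (Suc (Suc k))}. of_bool (perturbed_cone {1..m} v ?B (y(Suc k := x))) * real (card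
       (slice (perturbed_cone {1..m} v A) k (y(Suc k := x)))))
     (\<lambda>y. - (\<Sum>x\<in>{0..y (Suc (Suc k))}. of_bool (perturbed_cone {1..m} (\<lambda>i. - v i) ?B (y(Suc k := x))) *
        ((-1) ^ k * real (card (slice (perturbed_cone {1..m} (\<lambda>i. - v i) A) k (y(Suc k := x)))))))"
    by (rule reciprocal_pair_sum_between[OF gen _ _ _ _ _ _ IH]) (use Suc.prems in \<open>auto simp:
      neighbour_forms_def\<close>)
  moreover have "insert (Suc k) {1..k} = {1..Suc k}" by auto
  ultimately show ?case
    using step[where c=1 and u=v] step[where c="(-1)^k" and u="\<lambda>i. - v i"] by (simp del: fun_upd_apply)
qed

text \<open>
  Once \<open>x m\<close> is the only variable left, each inequality is \<open>a m * x m > 0\<close> in perturbed form.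
  For \<open>x m > 0\<close> its truth does not depend on the perturbation; for \<open>x m = 0\<close> the perturbation
  by \<open>v\<close> gives the same answer as \<open>x m > 0\<close> because \<open>v m > 0\<close>. So \<open>t = 0\<close> can be included for
  \<open>v\<close>, but not for \<open>- v\<close>.
\<close>
lemma reciprocal_pair_line:
  assumes "reciprocal_pair {1..m} v {1..<m} F G" "m \<ge> 1" "v m > 0"
  shows "\<exists>Q. univariate_qpoly Q \<and> (\<forall>t\<ge>0. F ((\<lambda>_. 0)(m := t)) = Q t) \<and> (\<forall>t>0. G ((\<lambda>_. 0)(m := t)) =
    Q (- t))"
  using assms(1)
proof induction
  case (gen B q)
  let ?l = "\<lambda>t. (\<lambda>_. 0)(m := t) :: nat \<Rightarrow> int"
  have lin: "lin {1..m} a y = of_int (a m) * y m" if "a \<in> B" for a and y :: "nat \<Rightarrow> 'a :: comm_ring_1"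
  proof -
    have "lin {1..m} a y = (\<Sum>i\<in>{m}. of_int (a i) * y i)" unfolding lin_def
      using gen(2)[OF that] assms(2) by (intro sum.mono_neutral_right) auto
    then show ?thesis by simp
  qed
  define good where "good \<longleftrightarrow> (\<forall>a\<in>B. a m > 0)"
  have F: "perturbed_cone {1..m} v B (?l t) \<longleftrightarrow> good" if "t \<ge> 0" for t
  proof -
    have "perturbed_pos {1..m} v a (?l t) \<longleftrightarrow> a m > 0" if "a \<in> B" for a
      unfolding perturbed_pos_def lin[OF that] using \<open>t \<ge> 0\<close> assms(3) by (auto simp: zero_less_mult_iff)
    then show ?thesis by (simp add: perturbed_cone_def good_def)
  qed
  have G: "perturbed_cone {1..m} (\<lambda>i. - v i) B (?l t) \<longleftrightarrow> good" if "t > 0" for t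
  proof -
    have "perturbed_pos {1..m} (\<lambda>i. - v i) a (?l t) \<longleftrightarrow> a m > 0" if "a \<in> B" for a
      unfolding perturbed_pos_def lin[OF that] using \<open>t > 0\<close> assms(3) by (auto simp: zero_less_mult_iff)
    then show ?thesis by (simp add: perturbed_cone_def good_def)
  qed
  have m: "(\<lambda>i. - ?l t i) = ?l (- t)" for t by (rule ext) simp
  show ?case
  proof (intro exI conjI allI impI)
    show "univariate_qpoly (\<lambda>t. if good then q (?l t) else 0)"
      using qpoly_line[OF gen(3), of m] univariate_qpoly_zero
        by (cases good) (simp_all del: fun_upd_apply)
  qed (simp_all add: F G m del: fun_upd_apply One_nat_def)
next
  case (add F G F' G')
  then obtain Q Q' where "univariate_qpoly Q" "\<forall>t\<ge>0. F ((\<lambda>_. 0)(m := t)) =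
    Q t" "\<forall>t>0. G ((\<lambda>_. 0)(m := t)) = Q (- t)"
    "univariate_qpoly Q'" "\<forall>t\<ge>0. F' ((\<lambda>_. 0)(m := t)) = Q' t" "\<forall>t>0. G' ((\<lambda>_. 0)(m := t)) =
      Q' (- t)" by blast
  then show ?case by (intro exI[of _ "\<lambda>t. Q t +
    Q' t"]) (simp add: univariate_qpoly_add del: fun_upd_apply)
qed

text \<open>
  Since every form in \<open>A\<close> is positive at \<open>v\<close>, perturbing by \<open>v\<close> describes the closed cone and
  perturbing by \<open>- v\<close> the open one.
\<close>
theorem cone_reciprocity:
  assumes m: "m \<ge> 1" and gen: "generic {1..m} v" and "v m > 0"
    and A: "finite A" "\<And>k. 1 \<le> k \<Longrightarrow> k < m \<Longrightarrow> neighbour_forms k \<subseteq> A"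
    and v: "\<And>a. a \<in> A \<Longrightarrow> lin {1..m} a v > 0"
  shows "\<exists>Q. univariate_qpoly Q \<and>
    (\<forall>t\<ge>0. Q t = card {x. (\<forall>i. i \<notin> {1..m} \<longrightarrow> x i = 0) \<and> x m = t \<and> (\<forall>a\<in>A. lin {1..m} a x \<ge> 0)}) \<and>
    (\<forall>t>0. (-1) ^ (m - 1) * Q (- t) =
       card {x. (\<forall>i. i \<notin> {1..m} \<longrightarrow> x i = 0) \<and> x m = t \<and> (\<forall>a\<in>A. lin {1..m} a x > 0)})"
proof -
  let ?l = "\<lambda>t. (\<lambda>_. 0)(m := t) :: nat \<Rightarrow> int" and ?w = "\<lambda>i. - v i"
  have "{1..m - 1} = {1..<m}" using m by auto
  then have "reciprocal_pair {1..m} v {1..<m} (\<lambda>y. real (card (slice (perturbed_cone {1..m} v A) (m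
    - 1) y)))
           (\<lambda>y. (-1) ^ (m - 1) * real (card (slice (perturbed_cone {1..m} ?w A) (m - 1) y)))"
    using reciprocal_pair_slice[OF gen A, of "m - 1"] m by simp
  from reciprocal_pair_line[OF this m assms(3)] obtain Q where Q: "univariate_qpoly Q"
    "\<And>t. t \<ge> 0 \<Longrightarrow> real (card (slice (perturbed_cone {1..m} v A) (m - 1) (?l t))) = Q t"
    "\<And>t. t > 0 \<Longrightarrow> (-1) ^ (m - 1) * real (card (slice (perturbed_cone {1..m} ?w A) (m - 1) (?l t))) =
      Q (- t)"
    by blast
  have cv: "perturbed_cone {1..m} v A x \<longleftrightarrow> (\<forall>a\<in>A. lin {1..m} a x \<ge> 0)" for x
    using v by (auto simp: perturbed_cone_def perturbed_pos_def order_le_less)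
  have cw: "perturbed_cone {1..m} ?w A x \<longleftrightarrow> (\<forall>a\<in>A. lin {1..m} a x > 0)" for x
    using v by (fastforce simp: perturbed_cone_def perturbed_pos_def lin_uminus_arg)
  have sl: "slice P (m - 1) (?l t) = {x. (\<forall>i. i \<notin> {1..m} \<longrightarrow> x i = 0) \<and> x m = t \<and> P x}" for P t
  proof -
    have "(\<forall>i. i \<notin> {1..m - 1} \<longrightarrow> x i = ?l t i) \<longleftrightarrow> (\<forall>i. i \<notin> {1..m} \<longrightarrow> x i = 0) \<and> x m = t" for x
    proof safe
      fix i assume "\<forall>i. i \<notin> {1..m - 1} \<longrightarrow> x i = ?l t i" "i \<notin> {1..m}"
      then show "x i = 0" by (metis atLeastAtMost_iff diff_le_self fun_upd_other le_trans m order_refl)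
    next
      assume "\<forall>i. i \<notin> {1..m - 1} \<longrightarrow> x i = ?l t i"
      then show "x m = t" using m by auto
    next
      fix i assume "\<forall>i. i \<notin> {1..m} \<longrightarrow> x i = 0" "t = x m" "i \<notin> {1..m - 1}"
      then show "x i = ?l (x m) i" by (cases "i = m") auto
    qed
    then show ?thesis by (simp add: slice_def)
  qed
  have "(-1) ^ (m - 1) * Q (- t) =
    card (slice (perturbed_cone {1..m} ?w A) (m - 1) (?l t))" if "t > 0" for t
    using Q(3)[OF that, symmetric]
      by (simp add: power_add[symmetric] mult.assoc[symmetric] power_mult_distrib[symmetric])
  then show ?thesis using Q(1) Q(2)[symmetric] unfolding sl cv cw by blast
qed

section \<open>Combinatorial types and multiplicities\<close>

text \<open>
  The pair of intervals \<open>{a+1..b}\<close>, \<open>{c+1..d}\<close>, coded by their end marks: in terms of marks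
  the corresponding sums are \<open>x b - x a\<close> and \<open>x d - x c\<close>.
\<close>
definition interval_pairs :: "nat \<Rightarrow> (nat \<times> nat \<times> nat \<times> nat) set" where
  "interval_pairs m = {(a, b, c, d). a < b \<and> b \<le> c \<and> c < d \<and> d \<le> m}"

definition excess :: "nat \<times> nat \<times> nat \<times> nat \<Rightarrow> (nat \<Rightarrow> 'a::comm_ring_1) \<Rightarrow> 'a" where
  "excess g z = (case g of (a, b, c, d) \<Rightarrow> sum z {Suc a..b} - sum z {Suc c..d})"

lemma finite_interval_pairs: "finite (interval_pairs m)"
  by (rule finite_subset[of _ "{..m} \<times> {..m} \<times> {..m} \<times> {..m}"]) (auto simp: interval_pairs_def)

lemma dpcs_iff:
  "dpcs m U V \<longleftrightarrow> (\<exists>a b c d. (a, b, c, d) \<in> interval_pairs m \<and> U = {Suc a..b} \<and> V = {Suc c..d})"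
proof
  assume "dpcs m U V"
  then obtain a b c d where "1 \<le> a" "a \<le> b" "b < c" "c \<le> d" "d \<le> m" "U = {a..b}" "V = {c..d}"
    by (auto simp: dpcs_def)
  then show "\<exists>a b c d. (a, b, c, d) \<in> interval_pairs m \<and> U = {Suc a..b} \<and> V = {Suc c..d}"
    by (intro exI[of _ "a - 1"] exI[of _ b] exI[of _ "c - 1"] exI[of _ d]) (auto simp:
      interval_pairs_def)
next
  assume "\<exists>a b c d. (a, b, c, d) \<in> interval_pairs m \<and> U = {Suc a..b} \<and> V = {Suc c..d}"
  then obtain a b c d where "a < b" "b \<le> c" "c < d" "d \<le> m" "U = {Suc a..b}" "V = {Suc c..d}"
    by (auto simp: interval_pairs_def)
  then show "dpcs m U V" unfolding dpcs_def
    by (intro exI[of _ "Suc a"] exI[of _ b] exI[of _ "Suc c"] exI[of _ d]) auto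
qed

lemma all_dpcs_iff:
  "(\<forall>U V. dpcs m U V \<longrightarrow> P (sum z U) (sum z V) (sum w U) (sum w V)) \<longleftrightarrow>
   (\<forall>a b c d. (a, b, c, d) \<in> interval_pairs m \<longrightarrow>
      P (sum z {Suc a..b}) (sum z {Suc c..d}) (sum w {Suc a..b}) (sum w {Suc c..d}))"
  unfolding dpcs_iff by blast

lemma all_interval_pairs_iff:
  "(\<forall>g\<in>interval_pairs m. P (excess g z) (excess g w)) \<longleftrightarrow>
   (\<forall>a b c d. (a, b, c, d) \<in> interval_pairs m \<longrightarrow>
      P (sum z {Suc a..b} - sum z {Suc c..d}) (sum w {Suc a..b} - sum w {Suc c..d}))"
  by (simp add: Ball_def split_paired_All excess_def)

lemma real_golomb_rulers_iff:
  "z \<in> real_golomb_rulers m \<longleftrightarrow> z \<in> {1..m} \<rightarrow>\<^sub>E {0..} \<and> (\<forall>g\<in>interval_pairs m. excess g z \<noteq> 0)"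
proof -
  have "(\<forall>U V. dpcs m U V \<longrightarrow> sum z U \<noteq> sum z V) \<longleftrightarrow> (\<forall>g\<in>interval_pairs m. excess g z \<noteq> 0)"
    using all_dpcs_iff[of m "\<lambda>x y _ _. x \<noteq> y" z z] all_interval_pairs_iff[of m "\<lambda>x y. x \<noteq> 0" z z] by simp
  then show ?thesis by (simp add: real_golomb_rulers_def real_golomb_rulers_of_length_def)
qed

text \<open>
  On Golomb rulers no difference of sums vanishes, so equivalence means that all of them have
  equal signs, a form that is symmetric and easy to perturb.
\<close>
lemma comb_equiv_iff:
  "(z, w) \<in> comb_equiv m \<longleftrightarrow> z \<in> real_golomb_rulers m \<and> w \<in> real_golomb_rulers m \<and>
     (\<forall>g\<in>interval_pairs m. 0 < excess g z * excess g w)"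
proof -
  have "(\<forall>g\<in>interval_pairs m. excess g z < 0 \<longleftrightarrow> excess g w < 0) \<longleftrightarrow>
    (\<forall>g\<in>interval_pairs m. 0 < excess g z * excess g w)"
    if "z \<in> real_golomb_rulers m" "w \<in> real_golomb_rulers m"
    using that unfolding real_golomb_rulers_iff
    by (intro ball_cong refl) (auto simp: zero_less_mult_iff not_less order_le_less)
  moreover have "(\<forall>U V. dpcs m U V \<longrightarrow> (sum z U < sum z V \<longleftrightarrow> sum w U < sum w V)) \<longleftrightarrow>
      (\<forall>g\<in>interval_pairs m. excess g z < 0 \<longleftrightarrow> excess g w < 0)"
    using all_dpcs_iff[of m "\<lambda>x y x' y'. x < y \<longleftrightarrow> x' < y'" z w]
      all_interval_pairs_iff[of m "\<lambda>x y. x < 0 \<longleftrightarrow> y < 0" z w] by simp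
  ultimately show ?thesis by (auto simp: comb_equiv_def)
qed

lemma equiv_comb_equiv: "equiv (real_golomb_rulers m) (comb_equiv m)"
proof (rule equivI)
  show "refl_on (real_golomb_rulers m) (comb_equiv m)"
    by (rule refl_onI) (auto simp: comb_equiv_iff real_golomb_rulers_iff zero_less_mult_iff)
  show "sym (comb_equiv m)" by (rule symI) (auto simp: comb_equiv_iff mult.commute)
  show "trans (comb_equiv m)"
  proof (rule transI)
    fix x y z assume "(x, y) \<in> comb_equiv m" "(y, z) \<in> comb_equiv m"
    then show "(x, z) \<in> comb_equiv m" by (fastforce simp: comb_equiv_iff zero_less_mult_iff)
  qed
  show "comb_equiv m \<subseteq> real_golomb_rulers m \<times> real_golomb_rulers m" by (auto simp: comb_equiv_iff)
qed

abbreviation classes :: "nat \<Rightarrow> (nat \<Rightarrow> real) set set" where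
  "classes m \<equiv> real_golomb_rulers m // comb_equiv m"

lemma finite_classes: "finite (classes m)"
proof (rule finite_subset)
  let ?C = "\<lambda>S. {w \<in> real_golomb_rulers m. \<forall>g\<in>interval_pairs m. excess g w > 0 \<longleftrightarrow> g \<in> S}"
  show "classes m \<subseteq> ?C ` Pow (interval_pairs m)"
  proof
    fix C assume "C \<in> classes m"
    then obtain z where z: "z \<in> real_golomb_rulers m" "C = comb_equiv m `` {z}" by (auto elim: quotientE)
    have "C = ?C {g \<in> interval_pairs m. excess g z > 0}"
      unfolding z(2) Image_singleton comb_equiv_iff
      using z(1) by (fastforce simp: real_golomb_rulers_iff zero_less_mult_iff not_less order_le_less)
    then show "C \<in> ?C ` Pow (interval_pairs m)" by blast
  qed
qed (simp add: finite_interval_pairs)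

lemma class_mem: "C \<in> classes m \<Longrightarrow> w \<in> C \<Longrightarrow> w' \<in> C \<longleftrightarrow> (w, w') \<in> comb_equiv m"
  using equiv_comb_equiv[of m] by (metis equiv_class_eq_iff quotient_eq_iff in_quotient_imp_closed)

lemma excess_dist:
  assumes "g \<in> interval_pairs m"
  shows "\<bar>excess g w - excess g z\<bar> \<le> (\<Sum>j\<in>{1..m}. \<bar>w j - z j :: real\<bar>)"
proof -
  obtain a b c d where g: "g = (a, b, c, d)" "a < b" "b \<le> c" "c < d" "d \<le> m" using assms
    by (auto simp: interval_pairs_def)
  have "\<bar>excess g w - excess g z\<bar> = \<bar>(\<Sum>j\<in>{Suc a..b}. w j - z j) - (\<Sum>j\<in>{Suc c..d}. w j - z j)\<bar>"
    by (simp add: excess_def g(1) sum_subtractf)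
  also have "\<dots> \<le> (\<Sum>j\<in>{Suc a..b}. \<bar>w j - z j\<bar>) + (\<Sum>j\<in>{Suc c..d}. \<bar>w j - z j\<bar>)"
    using sum_abs[of "\<lambda>j. w j - z j" "{Suc a..b}"] sum_abs[of "\<lambda>j. w j - z j" "{Suc c..d}"] by linarith
  also have "\<dots> = (\<Sum>j\<in>{Suc a..b} \<union> {Suc c..d}. \<bar>w j - z j\<bar>)"
    by (rule sum.union_disjoint[symmetric]) (use g in auto)
  also have "\<dots> \<le> (\<Sum>j\<in>{1..m}. \<bar>w j - z j\<bar>)" by (rule sum_mono2) (use g in auto)
  finally show ?thesis .
qed

lemma excess_add_scale: "excess g (\<lambda>j. x j + c * y j) = excess g x + c * excess g y"
  by (simp add: excess_def sum.distrib sum_distrib_left algebra_simps split: prod.split)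

lemma excess_cong: "g \<in> interval_pairs m \<Longrightarrow> (\<And>j. j \<in> {1..m} \<Longrightarrow> x j = y j) \<Longrightarrow> excess g x = excess g y"
  by (auto simp: excess_def interval_pairs_def intro!: arg_cong2[of _ _ _ _ "(-)"] sum.cong)

lemma excess_of_int: "excess g (\<lambda>j. real_of_int (z j)) = of_int (excess g z)"
  by (simp add: excess_def split: prod.split)

text \<open>
  The types near \<open>z\<close> are those whose closed cone contains \<open>z\<close>. If a type does not contain \<open>z\<close>
  in its closure, some difference of sums has the opposite sign at \<open>z\<close>; there it is a nonzero
  integer, so points of that type have distance at least \<open>1 / m\<close> from \<open>z\<close>. Conversely, moving
  from \<open>z\<close> a little in the direction of a ruler of the type enters its open cone.
\<close>
lemma golomb_multiplicity_eq:
  assumes z: "z \<in> rulers m t" and "m \<ge> 1"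
  shows "golomb_multiplicity m z =
    card {C \<in> classes m. \<forall>w\<in>C. \<forall>g\<in>interval_pairs m. 0 \<le> excess g w * of_int (excess g z)}"
proof -
  let ?B = "\<lambda>\<epsilon>. {w \<in> real_golomb_rulers m. L2_set (\<lambda>j. w j - real_of_int (z j)) {1..m} < \<epsilon>}"
  let ?K = "{C \<in> classes m. \<forall>w\<in>C. \<forall>g\<in>interval_pairs m. 0 \<le> excess g w * of_int (excess g z)}"
  have sub: "?B \<epsilon> // comb_equiv m \<subseteq> ?K" if "0 < \<epsilon>" "\<epsilon> < 1 / real m" for \<epsilon>
  proof
    fix C assume "C \<in> ?B \<epsilon> // comb_equiv m"
    then obtain w where w: "w \<in> real_golomb_rulers m" "L2_set (\<lambda>j. w j - real_of_int (z j)) {1..m} < \<epsilon>"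
      and C: "C = comb_equiv m `` {w}" by (auto elim: quotientE)
    have "0 \<le> excess g w' * of_int (excess g z)" if "w' \<in> C" and g: "g \<in> interval_pairs m" for w' g
    proof -
      have pos: "0 < excess g w * excess g w'" using that by (auto simp: C comb_equiv_iff)
      have "\<bar>w j - real_of_int (z j)\<bar> \<le> \<epsilon>" if "j \<in> {1..m}" for j
      proof -
        have "\<bar>w j - real_of_int (z j)\<bar> \<le> L2_set (\<lambda>j. \<bar>w j - real_of_int (z j)\<bar>) {1..m}"
          by (rule member_le_L2_set) (use that in auto)
        also have "\<dots> = L2_set (\<lambda>j. w j - real_of_int (z j)) {1..m}" by (simp add: L2_set_def)
        finally show ?thesis using w(2) by simp
      qed
      then have "(\<Sum>j\<in>{1..m}. \<bar>w j - real_of_int (z j)\<bar>) \<le> (\<Sum>j\<in>{1..m}. \<epsilon>)" by (intro sum_mono)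
      also have "\<dots> < 1" using \<open>\<epsilon> < 1 / real m\<close> assms(2) by (simp add: field_simps)
      finally have d: "\<bar>excess g w - of_int (excess g z)\<bar> < 1"
        using excess_dist[OF g, of w "\<lambda>j. real_of_int (z j)"] by (simp add: excess_of_int)
      have "0 \<le> excess g w * of_int (excess g z)"
      proof (cases "excess g z" "0::int" rule: linorder_cases)
        case less
        then have "real_of_int (excess g z) \<le> -1" by linarith
        with d have "excess g w < 0" by linarith
        then show ?thesis using less by (simp add: mult_nonpos_nonpos)
      next
        case greater
        then have "real_of_int (excess g z) \<ge> 1" by linarith
        with d have "excess g w > 0" by linarith
        then show ?thesis using greater by simp
      qed simp
      then show ?thesis using pos by (auto simp: zero_le_mult_iff zero_less_mult_iff)
    qed
    moreover have "C \<in> classes m" using w(1) C by (simp add: quotientI)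
    ultimately show "C \<in> ?K" by blast
  qed
  have sup: "?K \<subseteq> ?B \<epsilon> // comb_equiv m" if "0 < \<epsilon>" for \<epsilon>
  proof
    fix C assume "C \<in> ?K"
    then obtain v where v: "v \<in> real_golomb_rulers m" and C: "C = comb_equiv m `` {v}"
      and adh: "\<And>w g. w \<in> C \<Longrightarrow> g \<in> interval_pairs m \<Longrightarrow> 0 \<le> excess g w * of_int (excess g z)"
      by (auto elim: quotientE)
    have vC: "v \<in> C" using v equiv_comb_equiv by (auto simp: C dest: equiv_class_self)
    have v0: "0 \<le> v j" if "j \<in> {1..m}" for j using v that by (auto simp: real_golomb_rulers_iff)
    have z0: "0 \<le> z j" if "j \<in> {1..m}" for j using z that by (auto simp: rulers_def)
    define s where "s = (\<Sum>j\<in>{1..m}. v j)"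
    have s: "s \<ge> 0" unfolding s_def by (intro sum_nonneg v0)
    \<comment> \<open>\<open>s\<close> may vanish when \<open>m = 1\<close>, hence the summand \<open>1\<close>\<close>
    define \<delta> where "\<delta> = \<epsilon> / (1 + s)"
    have \<delta>: "\<delta> > 0" "\<delta> * s < \<epsilon>" using s \<open>0 < \<epsilon>\<close> by (simp_all add: \<delta>_def field_simps)
    define w where "w = (\<lambda>j\<in>{1..m}. real_of_int (z j) + \<delta> * v j)"
    have ew: "excess g w = of_int (excess g z) + \<delta> * excess g v" if "g \<in> interval_pairs m" for g
    proof -
      have "excess g w = excess g (\<lambda>j. real_of_int (z j) + \<delta> * v j)"
        by (rule excess_cong[OF that]) (simp add: w_def)
      then show ?thesis by (simp add: excess_add_scale excess_of_int)
    qed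
    have pos: "0 < excess g v * excess g w" if g: "g \<in> interval_pairs m" for g
    proof -
      have "excess g v \<noteq> 0" using v g by (auto simp: real_golomb_rulers_iff)
      then have "0 < \<delta> * (excess g v)\<^sup>2" using \<delta> by simp
      moreover have "0 \<le> excess g v * of_int (excess g z)" by (rule adh[OF vC g])
      ultimately show ?thesis by (simp add: ew[OF g] algebra_simps power2_eq_square)
    qed
    have w: "w \<in> real_golomb_rulers m"
      unfolding real_golomb_rulers_iff
    proof
      show "w \<in> {1..m} \<rightarrow>\<^sub>E {0..}" using v0 z0 \<delta>
        by (auto simp: w_def intro!: add_nonneg_nonneg mult_nonneg_nonneg)
      show "\<forall>g\<in>interval_pairs m. excess g w \<noteq> 0" using pos by force
    qed
    have "(v, w) \<in> comb_equiv m" using v w pos by (simp add: comb_equiv_iff)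
    then have "C = comb_equiv m `` {w}" unfolding C using equiv_comb_equiv by (metis equiv_class_eq)
    moreover have "L2_set (\<lambda>j. w j - real_of_int (z j)) {1..m} < \<epsilon>"
    proof -
      have "L2_set (\<lambda>j. w j - real_of_int (z j)) {1..m} \<le> (\<Sum>j\<in>{1..m}. \<bar>w j - real_of_int (z j)\<bar>)"
        by (rule L2_set_le_sum_abs)
      also have "\<dots> = (\<Sum>j\<in>{1..m}. \<delta> * v j)"
        by (intro sum.cong refl) (use v0 \<delta> in \<open>auto simp: w_def abs_mult\<close>)
      also have "\<dots> < \<epsilon>" using \<delta> by (simp add: s_def sum_distrib_left)
      finally show ?thesis .
    qed
    ultimately show "C \<in> ?B \<epsilon> // comb_equiv m" using w by (simp add: quotientI)
  qed
  have "\<forall>\<^sub>F \<epsilon> in at_right (0::real). 0 < \<epsilon> \<and> \<epsilon> < 1 / real m"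
    using assms(2) by (intro eventually_conj eventually_at_right_less eventually_at_right_real[THEN
      eventually_mono]) auto
  then have ev: "\<forall>\<^sub>F \<epsilon> in at_right (0::real). num_comb_different m (?B \<epsilon>) = card ?K"
  proof eventually_elim
    case (elim \<epsilon>)
    then have "?B \<epsilon> // comb_equiv m = ?K" by (intro equalityI sub sup) simp_all
    then show ?case by (simp add: num_comb_different_def)
  qed
  show ?thesis unfolding golomb_multiplicity_def
  proof (rule the_equality)
    fix n assume "\<forall>\<^sub>F \<epsilon> in at_right (0::real). num_comb_different m (?B \<epsilon>) = n"
    with ev have "\<forall>\<^sub>F \<epsilon> in at_right (0::real). n = card ?K" by eventually_elim simp
    then show "n = card ?K" by (simp add: trivial_limit_at_right_real)
  qed (rule ev)
qed

text \<open>
  The coordinates are chosen one by one, each outside the countable rational span of the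
  previous ones.
\<close>
lemma ex_generic:
  assumes "finite I" "\<And>j. j \<in> I \<Longrightarrow> l j < (u j :: real)"
  shows "\<exists>v. generic I v \<and> (\<forall>j\<in>I. l j < v j \<and> v j < u j)"
  using assms
proof (induction I rule: finite_induct)
  case empty show ?case by (auto simp: generic_def)
next
  case (insert k I)
  then obtain v where v: "generic I v" "\<And>j. j \<in> I \<Longrightarrow> l j < v j \<and> v j < u j" by blast
  define S where "S = (\<lambda>a. lin I a v) ` (I \<rightarrow>\<^sub>E UNIV)"
  define bad where "bad = (\<lambda>(x, b). - x / real_of_int b) ` (S \<times> UNIV)"
  have "countable S" unfolding S_def using insert(1) by (intro countable_image countable_PiE) auto
  then have "countable bad" unfolding bad_def by (intro countable_image countable_SIGMA) auto
  moreover have "uncountable {l k<..<u k}" using insert.prems[of k]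
    by (simp add: uncountable_open_interval)
  ultimately obtain c where c: "l k < c" "c < u k" "c \<notin> bad"
    by (metis countable_subset subsetI greaterThanLessThan_iff)
  define v' where "v' = v(k := c)"
  have lin: "lin (insert k I) a v' = of_int (a k) * c + lin I a v" for a
    using insert(1,2) by (auto simp: lin_def v'_def intro!: sum.cong)
  have "lin (insert k I) a v' \<noteq> 0" if a: "\<exists>i\<in>insert k I. a i \<noteq> 0" for a
  proof (cases "a k = 0")
    case True
    then show ?thesis using a v(1) by (auto simp: lin generic_def)
  next
    case False
    have "lin I a v = lin I (restrict a I) v" by (simp add: lin_def)
    then have "lin I a v \<in> S" by (auto simp: S_def)
    then have "- lin I a v / of_int (a k) \<in> bad" by (auto simp: bad_def)
    then have "c \<noteq> - lin I a v / of_int (a k)" using c by blast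
    then show ?thesis using False by (auto simp: lin field_simps)
  qed
  then have "generic (insert k I) v'" using insert(1) by (simp add: generic_def)
  moreover have "\<forall>j\<in>insert k I. l j < v' j \<and> v' j < u j" using v(2) c insert(2) by (auto simp: v'_def)
  ultimately show ?case by blast
qed

definition steps :: "nat \<Rightarrow> (nat \<Rightarrow> 'a::comm_ring_1) \<Rightarrow> nat \<Rightarrow> 'a" where
  "steps m x = (\<lambda>j\<in>{1..m}. x j - x (j - 1))"

lemma sum_steps: "a \<le> b \<Longrightarrow> b \<le> m \<Longrightarrow> sum (steps m x) {Suc a..b} = x b - x a"
proof (induction b rule: dec_induct)
  case (step n)
  have "{Suc a..Suc n} = insert (Suc n) {Suc a..n}" using step by auto
  then show ?case using step by (simp add: steps_def)
qed simp

lemma excess_steps: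
  "(a, b, c, d) \<in> interval_pairs m \<Longrightarrow> excess (a, b, c, d) (steps m x) = (x b - x a) - (x d - x c)"
  by (simp add: excess_def sum_steps interval_pairs_def)

text \<open>
  The cone of a type is open in the space of marks, so it contains points with generic marks.
  Placing the mark \<open>j\<close> slightly higher than before by an amount that grows with \<open>j\<close> also makes
  all the steps positive, including those that were zero.
\<close>
lemma ex_generic_equivalent:
  assumes z: "z \<in> real_golomb_rulers m"
  shows "\<exists>v. generic {1..m} v \<and> v 0 = 0 \<and> (\<forall>j\<in>{1..m}. 0 < steps m v j) \<and> (z, steps m v) \<in> comb_equiv m"
proof -
  have "\<exists>\<delta>>0. \<forall>g\<in>interval_pairs m. \<delta> < \<bar>excess g z\<bar>"
  proof -
    let ?M = "Min (insert 1 ((\<lambda>g. \<bar>excess g z\<bar>) ` interval_pairs m))"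
    have "?M > 0" using z finite_interval_pairs[of m] by (auto simp: real_golomb_rulers_iff)
    moreover have "?M \<le> \<bar>excess g z\<bar>" if "g \<in> interval_pairs m" for g
      using that finite_interval_pairs[of m] by (intro Min_le) auto
    ultimately show ?thesis by (intro exI[of _ "?M / 2"]) force
  qed
  then obtain \<eta> where \<eta>: "\<eta> > 0" "\<And>g. g \<in> interval_pairs m \<Longrightarrow> \<eta> < \<bar>excess g z\<bar>" by blast
  \<comment> \<open>each of the \<open>m\<close> steps changes by less than \<open>3 * \<delta>\<close>, so that no excess moves by
    more than \<open>\<eta>\<close>\<close>
  define \<delta> where "\<delta> = \<eta> / (3 * (real m + 1))"
  have \<delta>: "\<delta> > 0" using \<eta> by (simp add: \<delta>_def)
  define X where "X j = sum z {1..j}" for j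
  have X: "X (Suc j) = X j + z (Suc j)" for j by (simp add: X_def)
  \<comment> \<open>the offsets from the old marks lie in consecutive intervals of length \<open>\<delta>\<close> that are
    \<open>\<delta>\<close> apart, so each step grows\<close>
  obtain u where u: "generic {1..m} u"
    "\<And>j. j \<in> {1..m} \<Longrightarrow> X j + (2 * real j - 1) * \<delta> < u j \<and> u j < X j + 2 * real j * \<delta>"
    using ex_generic[of "{1..m}" "\<lambda>j. X j + (2 * real j - 1) * \<delta>" "\<lambda>j. X j + 2 * real j * \<delta>"] \<delta> by auto
  define v where "v = u(0 := 0)"
  have "lin {1..m} a v = lin {1..m} a u" for a unfolding lin_def v_def by (intro sum.cong) auto
  then have gen: "generic {1..m} v" using u(1) by (simp add: generic_def)
  have v: "X j + (2 * real j - 1) * \<delta> < v j \<and> v j \<le> X j + 2 * real j * \<delta>" if "j \<le> m" for j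
    using u(2)[of j] that \<delta> by (cases "j = 0") (auto simp: v_def X_def)
  have s: "z j < steps m v j \<and> steps m v j < z j + 3 * \<delta>" if j: "j \<in> {1..m}" for j
  proof -
    obtain i where i: "j = Suc i" using j by (cases j) auto
    show ?thesis using v[of i] v[of j] j \<delta> by (simp add: i steps_def X algebra_simps)
  qed
  have z0: "0 \<le> z j" if "j \<in> {1..m}" for j using z that by (auto simp: real_golomb_rulers_iff)
  have pos: "0 < excess g z * excess g (steps m v)" if g: "g \<in> interval_pairs m" for g
  proof -
    have "\<bar>excess g (steps m v) - excess g z\<bar> \<le> (\<Sum>j\<in>{1..m}. \<bar>steps m v j - z j\<bar>)"
      by (rule excess_dist[OF g])
    also have "\<dots> \<le> (\<Sum>j\<in>{1..m}. 3 * \<delta>)" by (intro sum_mono) (use s in force)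
    also have "\<dots> \<le> \<eta>" using \<eta>(1) by (simp add: \<delta>_def field_simps)
    also have "\<dots> < \<bar>excess g z\<bar>" by (rule \<eta>(2)[OF g])
    finally show ?thesis by (auto simp: zero_less_mult_iff abs_if split: if_splits)
  qed
  have "steps m v \<in> real_golomb_rulers m" unfolding real_golomb_rulers_iff
  proof
    show "steps m v \<in> {1..m} \<rightarrow>\<^sub>E {0..}"
    proof (rule PiE_I)
      fix j assume "j \<in> {1..m}" then show "steps m v j \<in> {0..}" using s z0 by force
    qed (auto simp: steps_def)
    show "\<forall>g\<in>interval_pairs m. excess g (steps m v) \<noteq> 0" using pos by force
  qed
  then have "(z, steps m v) \<in> comb_equiv m" using z pos by (simp add: comb_equiv_iff)
  moreover have "\<forall>j\<in>{1..m}. 0 < steps m v j" using s z0 by force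
  ultimately show ?thesis using gen by (intro exI[of _ v]) (simp add: v_def)
qed

lemma inj_on_steps:
  assumes "\<And>x i. x \<in> S \<Longrightarrow> i \<notin> {1..m} \<Longrightarrow> x i = e i"
  shows "inj_on (steps m) S"
proof (rule inj_onI)
  fix x y :: "nat \<Rightarrow> 'a" assume xy: "x \<in> S" "y \<in> S" and eq: "steps m x = steps m y"
  have 0: "x 0 = y 0" using assms[of x 0] assms[of y 0] xy by simp
  show "x = y"
  proof
    fix i
    have "x i - x 0 = y i - y 0" if "i \<le> m"
      using sum_steps[of 0 i m x] sum_steps[of 0 i m y] that eq by simp
    then show "x i = y i" using 0 assms[of x i] assms[of y i] xy by (cases "i \<le> m") auto
  qed
qed

lemma steps_PiE: "steps m x \<in> {1..m} \<rightarrow>\<^sub>E UNIV" by (simp add: steps_def)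

lemma steps_marks:
  assumes "z \<in> {1..m} \<rightarrow>\<^sub>E UNIV" "\<And>j. j \<le> m \<Longrightarrow> x j = sum z {1..j}"
  shows "steps m x = z"
proof
  fix j show "steps m x j = z j"
  proof (cases "j \<in> {1..m}")
    case True
    then obtain i where "j = Suc i" by (cases j) auto
    then show ?thesis using True assms(2)[of j] assms(2)[of i] by (simp add: steps_def)
  next
    case False then show ?thesis using assms(1) by (auto simp: steps_def)
  qed
qed

text \<open>
  Taking differences is a bijection between marks starting at \<open>0\<close> and rulers. The prescribed
  values \<open>e\<close> outside \<open>{1..m}\<close> cover both conventions for marks: zero, or undefined beyond the
  mark \<open>m\<close>.
\<close>
lemma card_steps:
  fixes e :: "nat \<Rightarrow> int" and t :: int
  assumes "e 0 = 0"
  shows "card {x. (\<forall>i. i \<notin> {1..m} \<longrightarrow> x i = e i) \<and> x m = t \<and> R (steps m x)} =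
    card {z \<in> {1..m} \<rightarrow>\<^sub>E UNIV. sum z {1..m} = t \<and> R z}" (is "card ?A = card ?B")
proof (rule bij_betw_same_card)
  show "bij_betw (steps m) ?A ?B" unfolding bij_betw_def
  proof
    show "inj_on (steps m) ?A" by (rule inj_on_steps[of _ _ e]) auto
    show "steps m ` ?A = ?B"
    proof (intro equalityI subsetI)
      fix z assume "z \<in> steps m ` ?A"
      then obtain x where x: "x \<in> ?A" "z = steps m x" by blast
      have "sum (steps m x) {1..m} = x m" using sum_steps[of 0 m m x] x assms by simp
      then show "z \<in> ?B" using x steps_PiE by auto
    next
      fix z assume z: "z \<in> ?B"
      define x where "x i = (if i \<in> {1..m} then sum z {1..i} else e i)" for i
      have s: "steps m x = z" using z assms by (intro steps_marks) (auto simp: x_def not_le)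
      have "x m = t" using z assms by (cases "m = 0") (auto simp: x_def)
      then have "x \<in> ?A" using z s by (simp add: x_def)
      then show "z \<in> steps m ` ?A" using s by blast
    qed
  qed
qed

section \<open>Reciprocity for the Golomb counting function\<close>

definition pos_rulers :: "nat \<Rightarrow> int \<Rightarrow> (nat \<Rightarrow> int) set" where
  "pos_rulers m t = {z \<in> {1..m} \<rightarrow>\<^sub>E UNIV. sum z {1..m} = t \<and> (\<forall>j\<in>{1..m}. 0 < z j)}"

definition golomb_rulers :: "nat \<Rightarrow> int \<Rightarrow> (nat \<Rightarrow> int) set" where
  "golomb_rulers m t = {z \<in> pos_rulers m t. \<forall>g\<in>interval_pairs m. excess g z \<noteq> 0}"

lemma rulers_alt: "rulers m t = {z \<in> {1..m} \<rightarrow>\<^sub>E UNIV. sum z {1..m} = t \<and> (\<forall>j\<in>{1..m}. 0 \<le> z j)}"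
  by (auto simp: rulers_def PiE_iff)

lemma finite_rulers: "finite (rulers m t)"
proof (rule finite_subset)
  show "rulers m t \<subseteq> {1..m} \<rightarrow>\<^sub>E {0..t}"
  proof
    fix z assume z: "z \<in> rulers m t"
    show "z \<in> {1..m} \<rightarrow>\<^sub>E {0..t}"
    proof (rule PiE_I)
      fix j assume j: "j \<in> {1..m}"
      have "z j \<le> sum z {1..m}" using z j by (intro member_le_sum) (auto simp: rulers_alt)
      then show "z j \<in> {0..t}" using z j by (auto simp: rulers_alt)
    next
      fix j assume "j \<notin> {1..m}" then show "z j = undefined" using z by (auto simp: rulers_def)
    qed
  qed
qed (simp add: finite_PiE)

lemma golomb_rulers_subset: "golomb_rulers m t \<subseteq> pos_rulers m t" "pos_rulers m t \<subseteq> rulers m t"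
  by (auto simp: golomb_rulers_def pos_rulers_def rulers_alt less_imp_le)

lemma strict_mono_on_iff_steps:
  fixes x :: "nat \<Rightarrow> int"
  shows "strict_mono_on {0..m} x \<longleftrightarrow> (\<forall>j\<in>{1..m}. 0 < steps m x j)"
proof
  assume s: "strict_mono_on {0..m} x"
  show "\<forall>j\<in>{1..m}. 0 < steps m x j"
  proof
    fix j assume "j \<in> {1..m}"
    moreover from this have "x (j - 1) < x j" by (intro strict_mono_onD[OF s]) auto
    ultimately show "0 < steps m x j" by (simp add: steps_def)
  qed
next
  assume p: "\<forall>j\<in>{1..m}. 0 < steps m x j"
  show "strict_mono_on {0..m} x"
  proof (rule strict_mono_onI)
    fix a b assume "a \<in> {0..m}" "b \<in> {0..m}" "a < b"
    then have "0 < sum (steps m x) {Suc a..b}" using p by (intro sum_pos) auto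
    then show "x a < x b" using sum_steps[of a b m x] \<open>a < b\<close> \<open>b \<in> {0..m}\<close> by simp
  qed
qed

text \<open>
  Two equal differences belong to distinct intervals of marks. If the intervals overlap,
  deleting the common part leaves equal sums over disjoint intervals; neither interval
  contains the other because the steps are positive.
\<close>
lemma inj_differences_iff:
  fixes x :: "nat \<Rightarrow> int"
  assumes "strict_mono_on {0..m} x"
  shows "inj_on (\<lambda>(j, k). x j - x k) {(j, k). k < j \<and> j \<le> m} \<longleftrightarrow>
    (\<forall>g\<in>interval_pairs m. excess g (steps m x) \<noteq> 0)"
proof
  assume inj: "inj_on (\<lambda>(j, k). x j - x k) {(j, k). k < j \<and> j \<le> m}"
  show "\<forall>g\<in>interval_pairs m. excess g (steps m x) \<noteq> 0"
  proof
    fix g assume g: "g \<in> interval_pairs m"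
    then obtain a b c d where g': "g = (a, b, c, d)" "a < b" "b \<le> c" "c < d" "d \<le> m"
      by (auto simp: interval_pairs_def)
    show "excess g (steps m x) \<noteq> 0"
    proof
      assume "excess g (steps m x) = 0"
      then have "x b - x a = x d - x c" using g by (simp add: g'(1) excess_steps)
      then have "(b, a) = (d, c)" using g' by (intro inj_onD[OF inj]) auto
      then show False using g' by simp
    qed
  qed
next
  assume ne: "\<forall>g\<in>interval_pairs m. excess g (steps m x) \<noteq> 0"
  have less: "x j < x k \<longleftrightarrow> j < k" if "j \<le> m" "k \<le> m" for j k
    using strict_mono_on_less[OF assms, of j k] that by simp
  have key: False if "x j - x k = x j' - x k'" "k < j" "j \<le> m" "k' < j'" "j' \<le> m" "k < k'" for j k j' k'
  proof -
    have "x k < x k'" using that less by simp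
    then have "x j < x j'" using that(1) by linarith
    then have "j < j'" using that less by simp
    show False
    proof (cases "j \<le> k'")
      case True
      then have "(k, j, k', j') \<in> interval_pairs m" using that by (auto simp: interval_pairs_def)
      then show False using ne that(1) excess_steps[of k j k' j' m x] by fastforce
    next
      case False
      then have "(k, k', j, j') \<in> interval_pairs m" using that \<open>j < j'\<close>
        by (auto simp: interval_pairs_def)
      then show False using ne that(1) excess_steps[of k k' j j' m x] by fastforce
    qed
  qed
  show "inj_on (\<lambda>(j, k). x j - x k) {(j, k). k < j \<and> j \<le> m}"
  proof (rule inj_onI, clarsimp)
    fix j k j' k' assume a: "x j - x k = x j' - x k'" "k < j" "j \<le> m" "k' < j'" "j' \<le> m"
    have "k = k'" using key[of j k j' k'] key[of j' k' j k] a by (cases k k' rule: linorder_cases) auto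
    moreover from this have "x j = x j'" using a by simp
    then have "j = j'" using less[of j j'] less[of j' j] a by (cases j j' rule: linorder_cases) auto
    ultimately show "j = j' \<and> k = k'" by simp
  qed
qed

lemma golomb_count_eq: "golomb_count m t = card (golomb_rulers m t)"
proof -
  define R where "R z \<longleftrightarrow> (\<forall>j\<in>{1..m}. 0 < z j) \<and>
    (\<forall>g\<in>interval_pairs m. excess g z \<noteq> 0)" for z :: "nat \<Rightarrow> int"
  let ?e = "\<lambda>i. if i = 0 then 0 else undefined :: int"
  have "golomb_count m t = card {x. (\<forall>i. i \<notin> {1..m} \<longrightarrow> x i = ?e i) \<and> x m = t \<and> R (steps m x)}"
    unfolding golomb_count_def
  proof (intro arg_cong[of _ _ card] Collect_cong)
    fix x :: "nat \<Rightarrow> int"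
    have "x \<in> {0..m} \<rightarrow>\<^sub>E UNIV \<and> x 0 = 0 \<longleftrightarrow> (\<forall>i. i \<notin> {1..m} \<longrightarrow> x i = ?e i)"
      by (auto simp: PiE_iff extensional_def)
    then show "x \<in> {0..m} \<rightarrow>\<^sub>E UNIV \<and> x 0 = 0 \<and> x m = t \<and> strict_mono_on {0..m} x \<and>
        inj_on (\<lambda>(j, k). x j - x k) {(j, k). k < j \<and> j \<le> m} \<longleftrightarrow>
        (\<forall>i. i \<notin> {1..m} \<longrightarrow> x i = ?e i) \<and> x m = t \<and> R (steps m x)"
      unfolding R_def using inj_differences_iff[of m x] strict_mono_on_iff_steps[of m x] by blast
  qed
  also have "\<dots> = card {z \<in> {1..m} \<rightarrow>\<^sub>E UNIV. sum z {1..m} = t \<and> R z}" by (rule card_steps) simp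
  also have "{z \<in> {1..m} \<rightarrow>\<^sub>E UNIV. sum z {1..m} = t \<and> R z} = golomb_rulers m t"
    by (auto simp: golomb_rulers_def pos_rulers_def R_def)
  finally show ?thesis .
qed

definition excess_form :: "nat \<times> nat \<times> nat \<times> nat \<Rightarrow> nat \<Rightarrow> int" where
  "excess_form g i = (case g of (a, b, c, d) \<Rightarrow> (unit b i - unit a i) - (unit d i - unit c i))"

lemma lin_excess_form:
  assumes "g \<in> interval_pairs m" "x 0 = 0"
  shows "lin {1..m} (excess_form g) x = excess g (steps m x)"
proof -
  obtain a b c d where g: "g = (a, b, c, d)" "a < b" "b \<le> c" "c < d" "d \<le> m" using assms(1)
    by (auto simp: interval_pairs_def)
  have f: "excess_form g = (\<lambda>i. (unit b i - unit a i) - (unit d i - unit c i))"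
    by (rule ext) (simp add: excess_form_def g(1))
  have u: "lin {1..m} (unit j) x = x j" if "j \<le> m" for j
    using that assms(2) by (cases "j = 0") (auto simp: lin_unit)
  show ?thesis unfolding f lin_diff using g assms(1) by (simp add: u excess_steps g(1) del: One_nat_def)
qed

text \<open>
  Inequalities for the cone of the type of \<open>v\<close>: the order of the marks and, for each pair of
  intervals, the sign that the excess has at \<open>v\<close>. The positivity of each mark gives the lower
  bound for its summation, and the next mark is the upper bound.
\<close>
definition class_forms :: "nat \<Rightarrow> (nat \<Rightarrow> real) \<Rightarrow> (nat \<Rightarrow> int) set" where
  "class_forms m v = unit ` {1..m} \<union> (\<Union>k\<in>{1..<m}. neighbour_forms k) \<union>
     (\<lambda>g i. (if excess g (steps m v) > 0 then 1 else -1) * excess_form g i) ` interval_pairs m"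

text \<open>
  Stated for a predicate closed under addition, to serve both the weak and the strict
  inequalities.
\<close>
lemma class_forms_iff:
  fixes x :: "nat \<Rightarrow> 'a :: linordered_idom" and P :: "'a \<Rightarrow> bool"
  assumes "x 0 = 0"
    and P: "\<And>s e. P s \<Longrightarrow> P e \<Longrightarrow> P (s + e)"
  shows "(\<forall>a\<in>class_forms m v. P (lin {1..m} a x)) \<longleftrightarrow>
    (\<forall>j\<in>{1..m}. P (steps m x j)) \<and>
    (\<forall>g\<in>interval_pairs m. P ((if excess g (steps m v) > 0 then 1 else -1) * excess g (steps m x)))"
proof -
  have 1: "(\<forall>a\<in>(\<lambda>g i. (if excess g (steps m v) > 0 then 1 else -1) * excess_form g i) `
    interval_pairs m. P (lin {1..m} a x)) \<longleftrightarrow>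
     (\<forall>g\<in>interval_pairs m. P ((if excess g (steps m v) > 0 then 1 else -1) * excess g (steps m x)))"
    using lin_excess_form[where x=x, OF _ assms(1)] by (simp add: lin_scale)
  have 2: "(\<forall>a\<in>unit ` {1..m} \<union> (\<Union>k\<in>{1..<m}. neighbour_forms k). P (lin {1..m} a x)) \<longleftrightarrow>
    (\<forall>j\<in>{1..m}. P (steps m x j))"
  proof
    assume a: "\<forall>a\<in>unit ` {1..m} \<union> (\<Union>k\<in>{1..<m}. neighbour_forms k). P (lin {1..m} a x)"
    show "\<forall>j\<in>{1..m}. P (steps m x j)"
    proof
      fix j assume j: "j \<in> {1..m}"
      show "P (steps m x j)"
      proof (cases "j = 1")
        case True
        have "P (lin {1..m} (unit 1) x)" using a j True by auto
        then show ?thesis using True j assms(1) by (simp add: steps_def lin_unit)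
      next
        case False
        then obtain i where i: "j = Suc i" "i \<ge> 1" using j by (cases j) auto
        have "(\<lambda>l. unit (Suc i) l - unit i l) \<in> (\<Union>k\<in>{1..<m}. neighbour_forms k)"
          using i j by (intro UN_I[of i]) (auto simp: neighbour_forms_def)
        then have "P (lin {1..m} (\<lambda>l. unit (Suc i) l - unit i l) x)" using a by blast
        then show ?thesis using i j by (simp add: steps_def lin_diff lin_unit)
      qed
    qed
  next
    assume s: "\<forall>j\<in>{1..m}. P (steps m x j)"
    have x: "P (x k)" if "1 \<le> k" "k \<le> m" for k using that
    proof (induction k rule: nat_induct_at_least)
      case base then show ?case using s[rule_format, of 1] assms(1) by (simp add: steps_def)
    next
      case (Suc n)
      then have "P (x n)" "P (x (Suc n) - x n)" using s[rule_format, of "Suc n"]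
        by (auto simp: steps_def)
      then show ?case using P[of "x n" "x (Suc n) - x n"] by simp
    qed
    have d: "P (x (Suc k) - x k)" if "1 \<le> k" "k < m" for k
      using s[rule_format, of "Suc k"] that by (simp add: steps_def)
    show "\<forall>a\<in>unit ` {1..m} \<union> (\<Union>k\<in>{1..<m}. neighbour_forms k). P (lin {1..m} a x)"
      using x d by (auto simp: neighbour_forms_def lin_diff lin_unit)
  qed
  show ?thesis unfolding class_forms_def using 1 2 by blast
qed

definition ruler_of_int :: "nat \<Rightarrow> (nat \<Rightarrow> int) \<Rightarrow> nat \<Rightarrow> real" where
  "ruler_of_int m z = (\<lambda>j\<in>{1..m}. real_of_int (z j))"

lemma excess_ruler_of_int: "g \<in> interval_pairs m \<Longrightarrow> excess g (ruler_of_int m z) = of_int (excess g z)"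
  using excess_cong[of g m "ruler_of_int m z" "\<lambda>j. real_of_int (z j)"]
    by (simp add: ruler_of_int_def excess_of_int)

lemma ruler_of_int_golomb_iff:
  assumes "\<forall>j\<in>{1..m}. 0 < z j"
  shows "ruler_of_int m z \<in> real_golomb_rulers m \<longleftrightarrow> (\<forall>g\<in>interval_pairs m. excess g z \<noteq> 0)"
proof -
  have "ruler_of_int m z \<in> {1..m} \<rightarrow>\<^sub>E {0..}" using assms by (auto simp: ruler_of_int_def less_imp_le)
  then show ?thesis by (simp add: real_golomb_rulers_iff excess_ruler_of_int)
qed

text \<open>
  A generic point \<open>v\<close> of the cone of \<open>C\<close> exists. Lattice points of the closed cone are the
  rulers to which the type \<open>C\<close> is close; those of the open cone are the Golomb rulers of type
  \<open>C\<close>.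
\<close>
theorem class_reciprocity:
  assumes m: "m \<ge> 1" and C: "C \<in> classes m"
  shows "\<exists>Q. univariate_qpoly Q \<and>
    (\<forall>t\<ge>0. Q t = card {z \<in> rulers m t. \<forall>w\<in>C. \<forall>g\<in>interval_pairs m. 0 \<le> excess g w * of_int (excess g
      z)}) \<and>
    (\<forall>t>0. (-1) ^ (m - 1) * Q (- t) = card {z \<in> golomb_rulers m t. ruler_of_int m z \<in> C})"
proof -
  obtain c where c: "c \<in> real_golomb_rulers m" "C = comb_equiv m `` {c}" using C
    by (auto elim: quotientE)
  obtain v where v: "generic {1..m} v" "v 0 = 0" "\<And>j. j \<in> {1..m} \<Longrightarrow>
    0 < steps m v j" "(c, steps m v) \<in> comb_equiv m"
    using ex_generic_equivalent[OF c(1)] by blast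
  let ?v = "steps m v"
  have vC: "?v \<in> C" using v(4) c by simp
  have v0: "excess g ?v \<noteq> 0" if "g \<in> interval_pairs m" for g using v(4) that
    by (auto simp: comb_equiv_iff)
  let ?A = "class_forms m v"
  have "v m = sum ?v {1..m}" using sum_steps[of 0 m m v] v(2) by simp
  also have "\<dots> > 0" using v(3) m by (intro sum_pos) auto
  finally have vm: "v m > 0" .
  have fin: "finite ?A" by (simp add: class_forms_def finite_interval_pairs neighbour_forms_def)
  have bnd: "neighbour_forms k \<subseteq> ?A" if "1 \<le> k" "k < m" for k using that by (auto simp: class_forms_def)
  have Av: "lin {1..m} a v > 0" if "a \<in> ?A" for a
    using class_forms_iff[of v "\<lambda>x. x > 0" m v] v(2,3) v0 that by (auto simp: not_less order_le_less)
  have weak: "(\<forall>a\<in>?A. 0 \<le> lin {1..m} a x) \<longleftrightarrow> (\<forall>j\<in>{1..m}. 0 \<le> steps m x j) \<and>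
      (\<forall>g\<in>interval_pairs m. 0 \<le> excess g ?v * of_int (excess g (steps m x)))" if "x 0 = 0" for x ::
        "nat \<Rightarrow> int"
  proof -
    have "0 \<le> (if excess g ?v > 0 then 1 else -1) * e \<longleftrightarrow>
      0 \<le> excess g ?v * real_of_int e" if "g \<in> interval_pairs m" for g and e :: int
      using v0[OF that] by (auto simp: zero_le_mult_iff)
    then show ?thesis using class_forms_iff[of x "\<lambda>x. x \<ge> 0" m v] that by simp
  qed
  have strict: "(\<forall>a\<in>?A. 0 < lin {1..m} a x) \<longleftrightarrow> (\<forall>j\<in>{1..m}. 0 < steps m x j) \<and>
      (\<forall>g\<in>interval_pairs m. 0 < excess g ?v * of_int (excess g (steps m x)))" if "x 0 = 0" for x ::
        "nat \<Rightarrow> int"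
  proof -
    have "0 < (if excess g ?v > 0 then 1 else -1) * e \<longleftrightarrow>
      0 < excess g ?v * real_of_int e" if "g \<in> interval_pairs m" for g and e :: int
      using v0[OF that] by (auto simp: zero_less_mult_iff)
    then show ?thesis using class_forms_iff[of x "\<lambda>x. x > 0" m v] that by simp
  qed
  have cong: "{x. (\<forall>i. i \<notin> {1..m} \<longrightarrow> x i = (0::int)) \<and> x m = t \<and> S x} =
      {x. (\<forall>i. i \<notin> {1..m} \<longrightarrow> x i = 0) \<and> x m = t \<and> R (steps m x)}" if "\<And>x. x 0 = 0 \<Longrightarrow> S x \<longleftrightarrow> R (steps m
        x)" for S R t
    using that by (intro Collect_cong) auto
  have 1: "card {x. (\<forall>i. i \<notin> {1..m} \<longrightarrow> x i = (0::int)) \<and> x m = t \<and> (\<forall>a\<in>?A. 0 \<le> lin {1..m} a x)} =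
     card {z \<in> rulers m t. \<forall>w\<in>C. \<forall>g\<in>interval_pairs m. 0 \<le> excess g w * of_int (excess g z)}" for t
  proof -
    have "(\<forall>g\<in>interval_pairs m. 0 \<le> excess g ?v * of_int (excess g z)) \<longleftrightarrow>
        (\<forall>w\<in>C. \<forall>g\<in>interval_pairs m. 0 \<le> excess g w * of_int (excess g z))" for z :: "nat \<Rightarrow> int"
    proof
      assume a: "\<forall>g\<in>interval_pairs m. 0 \<le> excess g ?v * of_int (excess g z)"
      show "\<forall>w\<in>C. \<forall>g\<in>interval_pairs m. 0 \<le> excess g w * of_int (excess g z)"
      proof (intro ballI)
        fix w g assume "w \<in> C" and g: "g \<in> interval_pairs m"
        then have "0 < excess g ?v * excess g w" using class_mem[OF C vC, of w]
          by (auto simp: comb_equiv_iff)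
        then show "0 \<le> excess g w * of_int (excess g z)" using a[rule_format, OF g]
          by (auto simp: zero_less_mult_iff zero_le_mult_iff)
      qed
    qed (use vC in blast)
    then have "{z \<in> {1..m} \<rightarrow>\<^sub>E UNIV. sum z {1..m} = t \<and> ((\<forall>j\<in>{1..m}. 0 \<le> z j) \<and>
          (\<forall>g\<in>interval_pairs m. 0 \<le> excess g ?v * of_int (excess g z)))} =
        {z \<in> rulers m t. \<forall>w\<in>C. \<forall>g\<in>interval_pairs m. 0 \<le> excess g w * of_int (excess g z)}"
      by (simp add: rulers_alt Collect_conj_eq Int_ac)
    moreover have "{x. (\<forall>i. i \<notin> {1..m} \<longrightarrow> x i = (0::int)) \<and> x m = t \<and> (\<forall>a\<in>?A. 0 \<le> lin {1..m} a x)} =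
       {x. (\<forall>i. i \<notin> {1..m} \<longrightarrow> x i = 0) \<and> x m = t \<and> ((\<forall>j\<in>{1..m}. 0 \<le> steps m x j) \<and>
          (\<forall>g\<in>interval_pairs m. 0 \<le> excess g ?v * of_int (excess g (steps m x))))}"
      by (rule cong[where R="\<lambda>z. (\<forall>j\<in>{1..m}. 0 \<le> z j) \<and>
          (\<forall>g\<in>interval_pairs m. 0 \<le> excess g ?v * of_int (excess g z))"], rule weak)
    ultimately show ?thesis
      using card_steps[of "\<lambda>_. 0" m t "\<lambda>z. (\<forall>j\<in>{1..m}. 0 \<le> z j) \<and>
          (\<forall>g\<in>interval_pairs m. 0 \<le> excess g ?v * of_int (excess g z))"] by simp
  qed
  have 2: "card {x. (\<forall>i. i \<notin> {1..m} \<longrightarrow> x i = (0::int)) \<and> x m = t \<and> (\<forall>a\<in>?A. 0 < lin {1..m} a x)} =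
     card {z \<in> golomb_rulers m t. ruler_of_int m z \<in> C}" for t
  proof -
    have "(\<forall>g\<in>interval_pairs m. 0 < excess g ?v * of_int (excess g z)) \<longleftrightarrow>
        (\<forall>g\<in>interval_pairs m. excess g z \<noteq> 0) \<and> ruler_of_int m z \<in> C" if "\<forall>j\<in>{1..m}. 0 < z j" for z
          :: "nat \<Rightarrow> int"
    proof -
      have "ruler_of_int m z \<in> real_golomb_rulers m \<longleftrightarrow> (\<forall>g\<in>interval_pairs m. excess g z \<noteq> 0)"
        by (rule ruler_of_int_golomb_iff[OF that])
      then show ?thesis using class_mem[OF C vC, of "ruler_of_int m z"] v(4)
        by (auto simp: comb_equiv_iff excess_ruler_of_int)
    qed
    then have "{z \<in> {1..m} \<rightarrow>\<^sub>E UNIV. sum z {1..m} = t \<and> ((\<forall>j\<in>{1..m}. 0 < z j) \<and>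
          (\<forall>g\<in>interval_pairs m. 0 < excess g ?v * of_int (excess g z)))} =
        {z \<in> golomb_rulers m t. ruler_of_int m z \<in> C}"
      by (auto simp: golomb_rulers_def pos_rulers_def)
    moreover have "{x. (\<forall>i. i \<notin> {1..m} \<longrightarrow> x i = (0::int)) \<and> x m = t \<and> (\<forall>a\<in>?A. 0 < lin {1..m} a x)} =
       {x. (\<forall>i. i \<notin> {1..m} \<longrightarrow> x i = 0) \<and> x m = t \<and> ((\<forall>j\<in>{1..m}. 0 < steps m x j) \<and>
          (\<forall>g\<in>interval_pairs m. 0 < excess g ?v * of_int (excess g (steps m x))))}"
      by (rule cong[where R="\<lambda>z. (\<forall>j\<in>{1..m}. 0 < z j) \<and>
          (\<forall>g\<in>interval_pairs m. 0 < excess g ?v * of_int (excess g z))"], rule strict)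
    ultimately show ?thesis
      using card_steps[of "\<lambda>_. 0" m t "\<lambda>z. (\<forall>j\<in>{1..m}. 0 < z j) \<and>
          (\<forall>g\<in>interval_pairs m. 0 < excess g ?v * of_int (excess g z))"] by simp
  qed
  show ?thesis using cone_reciprocity[OF m v(1) vm fin bnd Av] unfolding 1 2 .
qed

text \<open>
  Sum over the finitely many types: each Golomb ruler has one type, double counting turns the
  closed cones into multiplicities, and at \<open>t = 0\<close> each type contributes the origin.
\<close>
theorem golomb_reciprocity:
  assumes m: "m \<ge> 1"
  shows "\<exists>q. univariate_qpoly q \<and> (\<forall>t>0. q t = golomb_count m t) \<and>
     (\<forall>t>0. (-1) ^ (m - 1) * q (- t) = real (\<Sum>z\<in>rulers m t. golomb_multiplicity m z)) \<and>
     (-1) ^ (m - 1) * q 0 = real (num_comb_different m (real_golomb_rulers m))"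
proof -
  let ?W = "\<lambda>C z. \<forall>w\<in>C. \<forall>g\<in>interval_pairs m. 0 \<le> excess g w * real_of_int (excess g z)"
  have "\<forall>C. \<exists>Q. C \<in> classes m \<longrightarrow> univariate_qpoly Q \<and> (\<forall>t\<ge>0. Q t = card {z \<in> rulers m t. ?W C z}) \<and>
    (\<forall>t>0. (-1) ^ (m - 1) * Q (- t) = card {z \<in> golomb_rulers m t. ruler_of_int m z \<in> C})"
    using class_reciprocity[OF m] by blast
  from choice[OF this] obtain Q where Q: "\<And>C. C \<in> classes m \<Longrightarrow> univariate_qpoly (Q C)"
    "\<And>C t. C \<in> classes m \<Longrightarrow> t \<ge> 0 \<Longrightarrow> Q C t = card {z \<in> rulers m t. ?W C z}"
    "\<And>C t. C \<in> classes m \<Longrightarrow> t > 0 \<Longrightarrow> (-1) ^ (m - 1) * Q C (- t) =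
      card {z \<in> golomb_rulers m t. ruler_of_int m z \<in> C}"
    by blast
  define q where "q t = (\<Sum>C\<in>classes m. (-1) ^ (m - 1) * Q C (- t))" for t
  have sgn: "(-1) ^ (m - 1) * q (- t) = (\<Sum>C\<in>classes m. Q C t)" for t
  proof -
    have "(-1) ^ (m - 1) * ((-1) ^ (m - 1) * x) = (x :: real)" for x
      by (simp add: mult.assoc[symmetric] power_mult_distrib[symmetric])
    then show ?thesis by (simp add: q_def sum_distrib_left)
  qed
  have "univariate_qpoly q" unfolding q_def
    by (intro univariate_qpoly_sum finite_classes univariate_qpoly_reflect Q)
  moreover have "q t = golomb_count m t" if "t > 0" for t
  proof -
    let ?G = "\<lambda>C. {z \<in> golomb_rulers m t. ruler_of_int m z \<in> C}"
    have fin: "finite (golomb_rulers m t)" using golomb_rulers_subset finite_rulers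
      by (metis finite_subset)
    have "q t = (\<Sum>C\<in>classes m. real (card (?G C)))" unfolding q_def by (intro sum.cong refl Q(3) that)
    also have "\<dots> = real (\<Sum>C\<in>classes m. card (?G C))" by simp
    also have "(\<Sum>C\<in>classes m. card (?G C)) = card (\<Union>C\<in>classes m. ?G C)"
    proof (rule card_UN_disjoint[symmetric, OF finite_classes])
      show "\<forall>C\<in>classes m. \<forall>D\<in>classes m. C \<noteq> D \<longrightarrow> ?G C \<inter> ?G D = {}"
        using quotient_disj[OF equiv_comb_equiv[of m]] by blast
    qed (use fin in auto)
    also have "(\<Union>C\<in>classes m. ?G C) = golomb_rulers m t"
    proof -
      have "\<exists>C\<in>classes m. ruler_of_int m z \<in> C" if "z \<in> golomb_rulers m t" for z
      proof -
        have "ruler_of_int m z \<in> real_golomb_rulers m"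
          using that ruler_of_int_golomb_iff[of m z] by (auto simp: golomb_rulers_def pos_rulers_def)
        then show ?thesis using Union_quotient[OF equiv_comb_equiv[of m]] by blast
      qed
      then show ?thesis by blast
    qed
    finally show ?thesis by (simp add: golomb_count_eq)
  qed
  moreover have "(-1) ^ (m - 1) * q (- t) =
    real (\<Sum>z\<in>rulers m t. golomb_multiplicity m z)" if "t > 0" for t
  proof -
    have "(\<Sum>z\<in>rulers m t. golomb_multiplicity m z) = (\<Sum>z\<in>rulers m t. card {C \<in> classes m. ?W C z})"
      by (intro sum.cong refl golomb_multiplicity_eq m)
    also have "\<dots> = (\<Sum>z\<in>rulers m t. \<Sum>C\<in>classes m. of_bool (?W C z))"
      using finite_classes[of m] by (intro sum.cong refl) (simp add: Int_def)
    also have "\<dots> = (\<Sum>C\<in>classes m. \<Sum>z\<in>rulers m t. of_bool (?W C z))" by (rule sum.swap)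
    also have "\<dots> = (\<Sum>C\<in>classes m. card {z \<in> rulers m t. ?W C z})"
      using finite_rulers[of m t] by (intro sum.cong refl) (simp add: Int_def)
    also have "real \<dots> = (\<Sum>C\<in>classes m. Q C t)" using that by (simp add: Q(2))
    finally show ?thesis by (simp only: sgn)
  qed
  moreover have "(-1) ^ (m - 1) * q 0 = real (num_comb_different m (real_golomb_rulers m))"
  proof -
    have "Q C 0 = 1" if "C \<in> classes m" for C
    proof -
      have "{z \<in> rulers m 0. ?W C z} = {\<lambda>j\<in>{1..m}. 0}"
      proof (intro equalityI subsetI)
        fix z assume "z \<in> {z \<in> rulers m 0. ?W C z}"
        then have z: "z \<in> {1..m} \<rightarrow>\<^sub>E UNIV" "\<And>j. j \<in> {1..m} \<Longrightarrow> 0 \<le> z j" "sum z {1..m} = 0"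
          by (auto simp: rulers_alt)
        have "z j = (\<lambda>j\<in>{1..m}. 0) j" for j
        proof (cases "j \<in> {1..m}")
          case True
          then show ?thesis using z(2,3) sum_nonneg_eq_0_iff[of "{1..m}" z] by auto
        next
          case False
          then show ?thesis using PiE_arb[OF z(1) False] by (simp only: restrict_apply if_False)
        qed
        then show "z \<in> {\<lambda>j\<in>{1..m}. 0}" by blast
      next
        fix z :: "nat \<Rightarrow> int" assume z: "z \<in> {\<lambda>j\<in>{1..m}. 0}"
        have "excess g z = 0" if "g \<in> interval_pairs m" for g
          using excess_cong[OF that, of z "\<lambda>_. 0"] z by (simp add: excess_def split: prod.splits)
        then show "z \<in> {z \<in> rulers m 0. ?W C z}" using z by (auto simp: rulers_alt)
      qed
      then show ?thesis using Q(2)[OF that, of 0] by simp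
    qed
    then show ?thesis using sgn[of 0] by (simp add: num_comb_different_def)
  qed
  ultimately show ?thesis by blast
qed

section \<open>Growth and the leading coefficient\<close>

text \<open>
  Subtracting one from each entry leaves arbitrary sequences of natural numbers with sum
  \<open>t - m\<close>.
\<close>
lemma card_pos_rulers:
  assumes "m \<ge> 1" "t \<ge> int m"
  shows "card (pos_rulers m t) = (nat t - 1) choose (m - 1)"
proof -
  let ?L = "{l :: nat list. length l = m \<and> sum_list l = nat t - m}"
  let ?f = "\<lambda>z :: nat \<Rightarrow> int. map (\<lambda>i. nat (z (Suc i) - 1)) [0..<m]"
  have shift: "(\<Sum>j\<in>{1..m}. h j) = (\<Sum>i<m. h (Suc i))" for h :: "nat \<Rightarrow> int"
    using sum.shift_bounds_Suc_ivl[of h 0 m]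
      by (simp add: atLeastLessThanSuc_atLeastAtMost atLeast0LessThan)
  have "bij_betw ?f (pos_rulers m t) ?L" unfolding bij_betw_def
  proof
    show "inj_on ?f (pos_rulers m t)"
    proof (rule inj_onI)
      fix z w assume z: "z \<in> pos_rulers m t" and w: "w \<in> pos_rulers m t" and eq: "?f z = ?f w"
      show "z = w"
      proof
        fix j show "z j = w j"
        proof (cases "j \<in> {1..m}")
          case True
          then obtain i where i: "j = Suc i" "i < m" by (cases j) auto
          then have "nat (z j - 1) = nat (w j - 1)" using arg_cong[OF eq, of "\<lambda>l. l ! i"] by simp
          moreover have "0 < z j" "0 < w j" using z w True by (auto simp: pos_rulers_def)
          ultimately show ?thesis by linarith
        next
          case False then show ?thesis using z w by (auto simp: pos_rulers_def PiE_iff extensional_def)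
        qed
      qed
    qed
    show "?f ` pos_rulers m t = ?L"
    proof (intro equalityI subsetI)
      fix l assume "l \<in> ?f ` pos_rulers m t"
      then obtain z where z: "z \<in> pos_rulers m t" "l = ?f z" by blast
      have p: "0 < z (Suc i)" if "i < m" for i using z that by (auto simp: pos_rulers_def)
      have "int (sum_list l) = (\<Sum>i<m. z (Suc i) - 1)"
        using p by (simp add: z(2) interv_sum_list_conv_sum_set_nat atLeast0LessThan)
      also have "\<dots> = t - int m" using z(1) by (simp add: sum_subtractf shift[symmetric] pos_rulers_def)
      finally show "l \<in> ?L" using z(2) by auto
    next
      fix l assume l: "l \<in> ?L"
      define z where "z = (\<lambda>j\<in>{1..m}. int (l ! (j - 1)) + 1)"
      have "sum z {1..m} = (\<Sum>i<m. int (l ! i) + 1)" unfolding shift by (simp add: z_def)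
      also have "\<dots> = int (sum_list l) + int m" using l
        by (simp add: sum.distrib sum_list_sum_nth atLeast0LessThan)
      also have "\<dots> = t" using l assms by simp
      finally have "z \<in> pos_rulers m t" by (simp add: pos_rulers_def z_def)
      moreover have "?f z = l" using l by (intro nth_equalityI) (auto simp: z_def)
      ultimately show "l \<in> ?f ` pos_rulers m t" by blast
    qed
  qed
  then have "card (pos_rulers m t) = card ?L" by (rule bij_betw_same_card)
  also have "\<dots> = (nat t - m + m - 1) choose (nat t - m)" by (rule card_length_sum_list)
  also have "\<dots> = (nat t - 1) choose (m - 1)"
    using assms binomial_symmetric[of "m - 1" "nat t - 1"] by simp
  finally show ?thesis .
qed

text \<open>
  The equation determines the mark \<open>b\<close> from the others: it occurs with coefficient \<open>1\<close>, or \<open>2\<close>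
  if the intervals are adjacent. As \<open>0 < b < m\<close>, only \<open>m - 2\<close> of the \<open>m - 1\<close> inner marks
  remain free.
\<close>
lemma card_bad_rulers:
  assumes g: "g \<in> interval_pairs m" and "t \<ge> 0"
  shows "card {z \<in> pos_rulers m t. excess g z = 0} \<le> nat (t + 1) ^ (m - 2)"
proof -
  obtain a b c d where g': "g = (a, b, c, d)" "a < b" "b \<le> c" "c < d" "d \<le> m" using g
    by (auto simp: interval_pairs_def)
  define K where "K = {1..m - 1} - {b}"
  have K: "finite K" "card K = m - 2" using g' by (auto simp: K_def card_Diff_singleton)
  let ?S = "{z \<in> pos_rulers m t. excess g z = 0}"
  define x where "x z i = sum z {1..i}" for z :: "nat \<Rightarrow> int" and i
  let ?f = "\<lambda>z. restrict (x z) K"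
  have st: "steps m (x z) = z" if "z \<in> ?S" for z
    using that by (intro steps_marks) (auto simp: pos_rulers_def x_def)
  have ex: "(x z b - x z a) - (x z d - x z c) = 0" if "z \<in> ?S" for z
    using that excess_steps[of a b c d m "x z"] g g'(1) st[OF that] by simp
  have "inj_on ?f ?S"
  proof (rule inj_onI)
    fix z w assume z: "z \<in> ?S" and w: "w \<in> ?S" and eq: "?f z = ?f w"
    have 1: "x z i = x w i" if "i \<in> K" for i using fun_cong[OF eq, of i] that by simp
    have 2: "x z i = x w i" if "i \<le> m" "i \<noteq> b" for i
    proof (cases "i \<in> K")
      case False
      then have "i = 0 \<or> i = m" using that by (auto simp: K_def)
      then show ?thesis using z w by (auto simp: x_def pos_rulers_def)
    qed (rule 1)
    have "x z b = x w b"
    proof (cases "c = b")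
      case True
      then show ?thesis using ex[OF z] ex[OF w] 2[of a] 2[of d] g' by simp
    next
      case False
      then show ?thesis using ex[OF z] ex[OF w] 2[of a] 2[of d] 2[of c] g' by simp
    qed
    then have "x z i = x w i" if "i \<le> m" for i using 2 that by (cases "i = b") auto
    then have "steps m (x z) = steps m (x w)" by (auto simp: steps_def intro!: restrict_ext)
    then show "z = w" using st z w by simp
  qed
  moreover have "?f ` ?S \<subseteq> K \<rightarrow>\<^sub>E {0..t}"
  proof (intro image_subsetI)
    fix z assume z: "z \<in> ?S"
    have "0 \<le> x z i \<and> x z i \<le> t" if "i \<in> K" for i
    proof -
      have p: "0 \<le> z j" if "j \<in> {1..m}" for j using z that by (auto simp: pos_rulers_def less_imp_le)
      have "x z i \<le> sum z {1..m}" unfolding x_def by (rule sum_mono2) (use that p in \<open>auto simp: K_def\<close>)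
      moreover have "0 \<le> x z i" unfolding x_def by (rule sum_nonneg) (use that p in \<open>auto simp: K_def\<close>)
      ultimately show ?thesis using z by (simp add: pos_rulers_def)
    qed
    then show "?f z \<in> K \<rightarrow>\<^sub>E {0..t}" by auto
  qed
  ultimately have "card ?S \<le> card (K \<rightarrow>\<^sub>E {0..t})"
    by (rule card_inj_on_le) (simp add: finite_PiE K)
  also have "\<dots> = nat (t + 1) ^ (m - 2)" using K by (simp add: card_PiE)
  finally show ?thesis .
qed

lemma golomb_rulers_bounds:
  assumes "m \<ge> 1" "t \<ge> int m"
  shows "card (golomb_rulers m t) \<le> (nat t - 1) choose (m - 1)"
    and "(nat t - 1) choose (m - 1) \<le> card (golomb_rulers m t) + card (interval_pairs m) * nat (t +
      1) ^ (m - 2)"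
proof -
  have fin: "finite (pos_rulers m t)" using golomb_rulers_subset(2) finite_rulers
    by (metis finite_subset)
  show "card (golomb_rulers m t) \<le> (nat t - 1) choose (m - 1)"
    using card_mono[OF fin golomb_rulers_subset(1)] card_pos_rulers[OF assms] by simp
  have U: "pos_rulers m t = golomb_rulers m t \<union> (\<Union>g\<in>interval_pairs m. {z \<in> pos_rulers m t. excess g
    z = 0})"
    by (auto simp: golomb_rulers_def)
  have "card (pos_rulers m t) \<le> card (golomb_rulers m t) +
    card (\<Union>g\<in>interval_pairs m. {z \<in> pos_rulers m t. excess g z = 0})"
    using card_Un_le[of "golomb_rulers m t" "\<Union>g\<in>interval_pairs m. {z \<in> pos_rulers m t. excess g z = 0}"]
    by (simp only: U[symmetric])
  also have "card (\<Union>g\<in>interval_pairs m. {z \<in> pos_rulers m t. excess g z =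
    0}) \<le> (\<Sum>g\<in>interval_pairs m. card {z \<in> pos_rulers m t. excess g z = 0})"
    by (rule card_UN_le[OF finite_interval_pairs])
  also have "\<dots> \<le> (\<Sum>g\<in>interval_pairs m. nat (t + 1) ^ (m - 2))" using assms
    by (intro sum_mono card_bad_rulers) auto
  also have "\<dots> = card (interval_pairs m) * nat (t + 1) ^ (m - 2)" by simp
  finally show "(nat t - 1) choose (m - 1) \<le> card (golomb_rulers m t) +
    card (interval_pairs m) * nat (t + 1) ^ (m - 2)"
    using card_pos_rulers[OF assms] by simp
qed

lemma interval_pairs_empty: "m \<le> 1 \<Longrightarrow> interval_pairs m = {}" by (auto simp: interval_pairs_def)

lemma binomial_over_power:
  "(\<lambda>n. real ((n - 1) choose k) / real n ^ k) \<longlonglongrightarrow> 1 / fact k"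
proof -
  have lim: "(\<lambda>n. \<Prod>i<k. (real n - 1 - real i) / real n) \<longlonglongrightarrow> (\<Prod>i<k. 1)"
  proof (intro tendsto_prod)
    fix i
    have "(\<lambda>n. 1 - (1 + real i) / real n) \<longlonglongrightarrow> 1 - 0"
      by (intro tendsto_diff tendsto_const lim_const_over_n)
    moreover have "\<forall>\<^sub>F n in sequentially. 1 - (1 + real i) / real n = (real n - 1 - real i) / real n"
      using eventually_gt_at_top[of 0] by eventually_elim (simp add: field_simps)
    ultimately show "(\<lambda>n. (real n - 1 - real i) / real n) \<longlonglongrightarrow> 1" by (simp add: tendsto_cong)
  qed
  have "\<forall>\<^sub>F n in sequentially. (\<Prod>i<k. (real n - 1 - real i) / real n) / fact k =
    real ((n - 1) choose k) / real n ^ k"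
    using eventually_gt_at_top[of 0]
  proof eventually_elim
    case (elim n)
    have "real ((n - 1) choose k) = (\<Prod>i<k. real n - 1 - real i) / fact k"
      using elim by (simp add: binomial_gbinomial gbinomial_prod_rev atLeast0LessThan of_nat_diff)
    then show ?case by (simp add: prod_dividef)
  qed
  with tendsto_divide[OF lim tendsto_const[of "fact k"]] show ?thesis by (simp add: tendsto_cong)
qed

lemma golomb_growth:
  assumes m: "m \<ge> 1"
  shows "(\<lambda>n. real (card (golomb_rulers m (int n))) / real n ^ (m - 1)) \<longlonglongrightarrow> 1 / fact (m - 1)"
proof -
  define B where "B n = real ((n - 1) choose (m - 1)) / real n ^ (m - 1)" for n
  define E where "E n = real (card (interval_pairs m)) * (real (n +
    1) ^ (m - 2) / real n ^ (m - 1))" for n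
  have B: "B \<longlonglongrightarrow> 1 / fact (m - 1)" unfolding B_def by (rule binomial_over_power)
  have E: "E \<longlonglongrightarrow> 0"
  proof (cases "m \<ge> 2")
    case False
    then have "E = (\<lambda>_. 0)" by (intro ext) (simp add: E_def interval_pairs_empty)
    then show ?thesis by simp
  next
    case True
    have inv: "(\<lambda>n. 1 / real n) \<longlonglongrightarrow> 0" by (rule lim_const_over_n)
    have "(\<lambda>n. real (card (interval_pairs m)) * ((1 +
      1 / real n) ^ (m - 2) * (1 / real n))) \<longlonglongrightarrow> real (card (interval_pairs m)) * ((1 + 0) ^ (m - 2) * 0)"
      by (intro tendsto_mult tendsto_power tendsto_add tendsto_const inv)
    moreover have "\<forall>\<^sub>F n in sequentially. real (card (interval_pairs m)) * ((1 +
      1 / real n) ^ (m - 2) * (1 / real n)) = E n"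
      using eventually_gt_at_top[of 0]
    proof eventually_elim
      case (elim n)
      have "m - 1 = Suc (m - 2)" using True by simp
      moreover have "1 + 1 / real n = real (n + 1) / real n" using elim by (simp add: field_simps)
      ultimately show ?case by (simp add: E_def power_divide)
    qed
    ultimately show ?thesis by (simp add: tendsto_cong)
  qed
  show ?thesis
  proof (rule tendsto_sandwich)
    show "(\<lambda>n. B n - E n) \<longlonglongrightarrow> 1 / fact (m - 1)" using tendsto_diff[OF B E] by simp
    show "\<forall>\<^sub>F n in sequentially. B n - E n \<le> real (card (golomb_rulers m (int n))) / real n ^ (m - 1)"
      using eventually_ge_at_top[of m]
    proof eventually_elim
      case (elim n)
      have "real ((n - 1) choose (m - 1)) \<le> real (card (golomb_rulers m (int n)) +
        card (interval_pairs m) * (n + 1) ^ (m - 2))"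
        using golomb_rulers_bounds(2)[OF m, of "int n"] elim
          by (simp only: of_nat_le_iff nat_int nat_int_add of_nat_1 flip: of_nat_add) (simp add:
            nat_add_distrib)
      then have "B n \<le> real (card (golomb_rulers m (int n)) + card (interval_pairs m) * (n +
        1) ^ (m - 2)) / real n ^ (m - 1)"
        unfolding B_def by (rule divide_right_mono) simp
      then show ?case by (simp add: E_def add_divide_distrib)
    qed
    show "\<forall>\<^sub>F n in sequentially. real (card (golomb_rulers m (int n))) / real n ^ (m - 1) \<le> B n"
      using eventually_ge_at_top[of m]
    proof eventually_elim
      case (elim n)
      then show ?case unfolding B_def
        using golomb_rulers_bounds(1)[OF m, of "int n"] by (intro divide_right_mono) auto
    qed
  qed (rule B)
qed

lemma periodic_common:
  "finite J \<Longrightarrow> (\<And>j. j \<in> J \<Longrightarrow> periodic (c j)) \<Longrightarrow> \<exists>p>0. \<forall>j\<in>J. \<forall>t. c j (t + p) = c j t"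
proof (induction J rule: finite_induct)
  case empty show ?case by (intro exI[of _ 1]) auto
next
  case (insert i J)
  then obtain p where p: "p > 0" "\<forall>j\<in>J. \<forall>t. c j (t + p) = c j t" by auto
  obtain q where q: "q > 0" "\<forall>t. c i (t + q) = c i t" using insert.prems[of i]
    by (auto simp: periodic_def)
  have "c i (t + p * q) = c i t" for t
    using periodic_mult_period[OF q(2), of t "nat p"] p by (simp add: mult.commute)
  moreover have "c j (t + p * q) = c j t" if "j \<in> J" for t j
    using periodic_mult_period[of "c j" p t "nat q"] p(2) q that by simp
  ultimately show ?case using p q by (intro exI[of _ "p * q"]) auto
qed

text \<open>
  Along the residue class of \<open>t\<close> modulo a common period the function is a polynomial in \<open>n\<close>,
  and its growth determines the coefficients from the top down.
\<close>
lemma leading_coefficient_from_limit: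
  assumes c: "\<And>j. periodic (c j)" and lim: "(\<lambda>n. (\<Sum>j\<le>D. c j (int n) * real n ^ j) / real n ^ d) \<longlonglongrightarrow> L"
    and "d \<le> D"
  shows "(\<forall>j. d < j \<and> j \<le> D \<longrightarrow> c j t = 0) \<and> c d t = L"
proof -
  obtain p where p: "p > 0" "\<forall>j\<in>{..D}. \<forall>t. c j (t + p) = c j t"
    using periodic_common[of "{..D}" c] c by auto
  define r where "r = nat (t mod p)"
  \<comment> \<open>the residue class of \<open>t\<close>, shifted to natural numbers so that it can tend to
    infinity\<close>
  define s where "s n = r + nat p * n" for n
  have "strict_mono s" unfolding s_def by (rule strict_monoI) (use p in simp)
  then have s: "filterlim s at_top sequentially" by (rule filterlim_subseq)
  have cs: "c j (int (s n)) = c j t" if "j \<le> D" for j n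
  proof -
    have P: "\<forall>t. c j (t + p) = c j t" using p(2) that by simp
    have "c j (int (s n)) = c j (t mod p + p * int n)" using p(1) by (simp add: s_def r_def)
    also have "\<dots> = c j (t mod p)" by (rule periodic_mult_period[OF P])
    also have "\<dots> = c j t" by (rule periodic_eq_mod[OF P p(1), symmetric])
    finally show ?thesis .
  qed
  have sub: "(\<lambda>n. (\<Sum>j\<le>D. c j t * real (s n) ^ j) / real (s n) ^ d) \<longlonglongrightarrow> L"
  proof -
    have "(\<lambda>n. (\<Sum>j\<le>D. c j (int (s n)) * real (s n) ^ j) / real (s n) ^ d) \<longlonglongrightarrow> L"
      using filterlim_compose[OF lim s] .
    moreover have "(\<Sum>j\<le>D. c j (int (s n)) * real (s n) ^ j) = (\<Sum>j\<le>D. c j t * real (s n) ^ j)" for n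
      by (intro sum.cong refl) (simp add: cs)
    ultimately show ?thesis by simp
  qed
  have sreal: "filterlim (\<lambda>n. real (s n)) at_top sequentially"
    by (rule filterlim_compose[OF filterlim_real_sequentially s])
  have inv: "(\<lambda>n. inverse (real (s n))) \<longlonglongrightarrow> 0"
    by (rule filterlim_compose[OF tendsto_inverse_0_at_top[OF filterlim_ident] sreal])
  have top: "(\<lambda>n. (\<Sum>j\<le>e. c j t * real (s n) ^ j) / real (s n) ^ e) \<longlonglongrightarrow> c e t" for e
  proof -
    have "(\<lambda>n. \<Sum>j\<le>e. c j t * inverse (real (s n)) ^ (e - j)) \<longlonglongrightarrow> (\<Sum>j\<le>e. c j t * 0 ^ (e - j))"
      by (intro tendsto_sum tendsto_mult tendsto_const tendsto_power inv)
    also have "(\<Sum>j\<le>e. c j t * 0 ^ (e - j)) = (\<Sum>j\<le>e. if j = e then c e t else 0)"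
      by (intro sum.cong refl) auto
    also have "\<dots> = c e t" by simp
    finally have l: "(\<lambda>n. \<Sum>j\<le>e. c j t * inverse (real (s n)) ^ (e - j)) \<longlonglongrightarrow> c e t" .
    have "\<forall>\<^sub>F n in sequentially. real (s n) > 0" using sreal unfolding filterlim_at_top_dense by blast
    then have "\<forall>\<^sub>F n in sequentially. (\<Sum>j\<le>e. c j t * inverse (real (s n)) ^ (e - j)) =
        (\<Sum>j\<le>e. c j t * real (s n) ^ j) / real (s n) ^ e"
    proof eventually_elim
      case (elim n)
      have "inverse (real (s n)) ^ (e - j) = real (s n) ^ j / real (s n) ^ e" if "j \<le> e" for j
      proof -
        have "real (s n) ^ e = real (s n) ^ j * real (s n) ^ (e - j)" using that
          by (simp flip: power_add)
        then show ?thesis using elim by (simp add: power_inverse field_simps)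
      qed
      then show ?case unfolding sum_divide_distrib by (intro sum.cong refl) simp
    qed
    with l show ?thesis by (simp add: tendsto_cong)
  qed
  have zero: "c j t = 0" if "d < j" "j \<le> D" for j
  proof (rule ccontr)
    assume "c j t \<noteq> 0"
    define e where "e = Max {j. j \<le> D \<and> c j t \<noteq> 0}"
    have fin: "finite {j. j \<le> D \<and> c j t \<noteq> 0}" by simp
    have e: "e \<le> D" "c e t \<noteq> 0" "j \<le> e"
      using Max_in[OF fin] Max_ge[OF fin, of j] \<open>c j t \<noteq> 0\<close> that unfolding e_def by blast+
    have above: "c i t = 0" if "i \<le> D" "e < i" for i
      using Max_ge[OF fin, of i] that unfolding e_def by fastforce
    have trunc: "(\<Sum>j\<le>D. c j t * real (s n) ^ j) = (\<Sum>j\<le>e. c j t * real (s n) ^ j)" for n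
      using e(1) above by (intro sum.mono_neutral_right) (auto simp: not_le)
    have "(\<lambda>n. (\<Sum>j\<le>D. c j t * real (s n) ^ j) / real (s n) ^ d * inverse (real (s n)) ^ (e - d)) \<longlonglongrightarrow> L
      * 0 ^ (e - d)"
      by (intro tendsto_mult sub tendsto_power inv)
    moreover have "(0::real) ^ (e - d) = 0" using that e(3) by simp
    moreover have "\<forall>\<^sub>F n in sequentially. real (s n) > 0" using sreal
      unfolding filterlim_at_top_dense by blast
    then have "\<forall>\<^sub>F n in sequentially. (\<Sum>j\<le>D. c j t * real (s n) ^ j) / real (s n) ^ d * inverse
      (real (s n)) ^ (e - d) =
        (\<Sum>j\<le>e. c j t * real (s n) ^ j) / real (s n) ^ e"
    proof eventually_elim
      case (elim n)
      have "real (s n) ^ e = real (s n) ^ d * real (s n) ^ (e - d)" using that e(3)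
        by (simp flip: power_add)
      then show ?case using elim by (simp add: trunc field_simps)
    qed
    ultimately have "(\<lambda>n. (\<Sum>j\<le>e. c j t * real (s n) ^ j) / real (s n) ^ e) \<longlonglongrightarrow> 0"
      by (simp add: tendsto_cong)
    with top[of e] have "c e t = 0" using LIMSEQ_unique by blast
    with e show False by simp
  qed
  moreover have "c d t = L"
  proof -
    have "(\<Sum>j\<le>D. c j t * real (s n) ^ j) = (\<Sum>j\<le>d. c j t * real (s n) ^ j)" for n
      using assms(3) zero by (intro sum.mono_neutral_right) (auto simp: not_le)
    then show ?thesis using top[of d] sub LIMSEQ_unique by force
  qed
  ultimately show ?thesis by blast
qed

theorem theorem1:
  fixes m :: nat
  assumes "m \<ge> 1"
  shows "\<exists>(q :: int \<Rightarrow> real) (c :: nat \<Rightarrow> int \<Rightarrow> real).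
           quasipolynomial (m - 1) c q \<and>
           (\<forall>t. c (m - 1) t = 1 / fact (m - 1)) \<and>
           (\<forall>t>0. q t = real (golomb_count m t)) \<and>
           (\<forall>t>0. (-1) ^ (m - 1) * q (- t) = real (\<Sum>z\<in>rulers m t. golomb_multiplicity m z)) \<and>
           (-1) ^ (m - 1) * q 0 = real (num_comb_different m (real_golomb_rulers m))"
proof -
  obtain q where q: "univariate_qpoly q" "\<And>t. t > 0 \<Longrightarrow> q t = golomb_count m t"
    "\<forall>t>0. (-1) ^ (m - 1) * q (- t) = real (\<Sum>z\<in>rulers m t. golomb_multiplicity m z)"
    "(-1) ^ (m - 1) * q 0 = real (num_comb_different m (real_golomb_rulers m))"
    using golomb_reciprocity[OF assms] by blast
  obtain D0 c0 where c0: "\<And>j. periodic (c0 j)" "\<And>t. q t = (\<Sum>j\<le>D0. c0 j t * of_int t ^ j)"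
    using q(1) unfolding univariate_qpoly_def by blast
  define D where "D = max D0 (m - 1)"
  define c where "c j = (if j \<le> D0 then c0 j else (\<lambda>_. 0))" for j
  have c: "periodic (c j)" for j using c0(1) periodic_const by (simp add: c_def)
  have qc: "q t = (\<Sum>j\<le>D. c j t * of_int t ^ j)" for t
    unfolding c0(2) by (intro sum.mono_neutral_cong_left) (auto simp: c_def D_def)
  have "(\<lambda>n. q (int n) / real n ^ (m - 1)) \<longlonglongrightarrow> 1 / fact (m - 1)"
  proof -
    have "\<forall>\<^sub>F n in sequentially. real (card (golomb_rulers m (int n))) / real n ^ (m - 1) =
      q (int n) / real n ^ (m - 1)"
      using eventually_gt_at_top[of 0] by eventually_elim (simp add: q(2) golomb_count_eq)
    then show ?thesis by (rule Lim_transform_eventually[OF golomb_growth[OF assms]])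
  qed
  then have "(\<lambda>n. (\<Sum>j\<le>D. c j (int n) * real n ^ j) / real n ^ (m - 1)) \<longlonglongrightarrow> 1 / fact (m - 1)"
    by (simp add: qc)
  from leading_coefficient_from_limit[OF c this] have lead: "\<And>j t. m - 1 < j \<Longrightarrow> j \<le> D \<Longrightarrow> c j t =
    0" "\<And>t. c (m - 1) t = 1 / fact (m - 1)"
    by (auto simp: D_def)
  have "q t = (\<Sum>j\<le>m - 1. c j t * of_int t ^ j)" for t
    unfolding qc by (intro sum.mono_neutral_right) (auto simp: D_def not_le intro: lead(1))
  moreover have "c (m - 1) \<noteq> (\<lambda>_. 0)" using lead(2)[of 0]
    by (metis divide_eq_0_iff fact_nonzero zero_neq_one)
  ultimately have "quasipolynomial (m - 1) c q" using c by (simp add: quasipolynomial_def)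
  then show ?thesis using lead(2) q(2-4) by blast
qed

end
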